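(* Let $1\le q,r<\infty$, let $s=\max(q,r)$ and let $\alpha\ge 3$. Let $T$ be a sublinear operator satisfying the $W_q$ condition with a non-increasing function $\psi_{T,q}$ on $(0,1)$, and suppose that $\mathcal M^{\#}_{T,\alpha}$ is of weak type $(r,r)$. Then for every compactly supported $f\in L^s(\mathbb R^n)$ there exists a $\frac{1}{2\cdot\alpha^n}$-sparse family $\mathcal S$ of cubes such that $$|Tf(x)|\le C\sum_{Q\in\mathcal S}\langle f\rangle_{s,Q}\,\chi_Q(x)\quad\text{for a.e. }x\in\mathbb R^n,$$ where $$C=c_{n,r,s,\alpha}\left(\psi_{T,q}\Big(\frac{1}{12\cdot(2\alpha)^n}\Big)+\|\mathcal M^{\#}_{T,\alpha}\|_{L^r\to L^{r,\infty}}\right)$$ and the constant $c_{n,r,s,\alpha}$ depends only on $n,r,s,\alpha$.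
   Context: Cubes are cubes in $\mathbb R^n$ (with sides parallel to the axes); for $\lambda>0$, $\lambda Q$ is the cube with the same center as $Q$ and side length $\lambda$ times that of $Q$. $|E|$ is Lebesgue measure and $\chi_E$ the indicator function of $E$. For $1\le p<\infty$, $\langle f\rangle_{p,Q}=\big(\frac1{|Q|}\int_Q|f|^p\big)^{1/p}$. A family $\mathcal S$ of cubes is $\eta$-sparse, $0<\eta\le1$, if for every $Q\in\mathcal S$ there is a measurable set $E_Q\subset Q$ with $|E_Q|\ge\eta|Q|$ and the sets $\{E_Q\}_{Q\in\mathcal S}$ are pairwise disjoint. $T$ is an operator taking functions on $\mathbb R^n$ to measurable functions on $\mathbb R^n$, defined on all the functions to which it is applied here. Sublinear has the usual meaning: $|T(f+g)|\le|Tf|+|Tg|$ and $|T(cf)|=|c||Tf|$ for scalars $c$, a.e. $T$ satisfies the $W_q$ condition if there is a non-increasing function $\psi_{T,q}(\lambda)$, $0<\lambda<1$, such that for every cube $Q$ and every $f\in L^q(Q)$, $$|\{x\in Q:|T(f\chi_Q)(x)|>\psi_{T,q}(\lambda)\langle f\rangle_{q,Q}\}|\le\lambda|Q|\quad(0<\lambda<1).$$ For $\alpha>0$, $$\mathcal M^{\#}_{T,\alpha}f(x)=\sup_{Q\ni x}\ \operatorname*{ess\,sup}_{x',x''\in Q}\big|T(f\chi_{\mathbb R^n\setminus\alpha Q})(x')-T(f\chi_{\mathbb R^n\setminus\alpha Q})(x'')\big|,$$ the supremum being over all cubes $Q$ containing $x$. An operator is of weak type $(r,r)$ if it is bounded from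 $L^r(\mathbb R^n)$ to $L^{r,\infty}(\mathbb R^n)$, with norm denoted $\|\cdot\|_{L^r\to L^{r,\infty}}$. *)

theory Defs
  imports "HOL-Probability.Essential_Supremum"
begin

text \<open>Functions are defined on \<open>real ^ 'n\<close>, i.e. on $\mathbb{R}^n$ with \<open>n = CARD('n)\<close>. The scalar
  type \<open>'k :: {real_normed_field, euclidean_space}\<close> covers both \<open>real\<close> and \<open>complex\<close>.\<close>

subsection \<open>Cubes, averages and sparse families\<close>

text \<open>The closed cube with centre \<open>c\<close> and side length \<open>l\<close>. It is a genuine cube only for \<open>0 < l\<close>.
  The dilate of \<open>cube c l\<close> by \<open>a > 0\<close> is \<open>cube c (a * l)\<close>.\<close>
definition cube :: "real ^ 'n \<Rightarrow> real \<Rightarrow> (real ^ 'n) set"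
  where "cube c l = cbox (c - vec (l / 2)) (c + vec (l / 2))"

definition cubes :: "(real ^ 'n) set set"
  where "cubes = {cube c l | c l. 0 < l}"

definition restr :: "'a set \<Rightarrow> ('a \<Rightarrow> 'k::real_vector) \<Rightarrow> 'a \<Rightarrow> 'k"
  where "restr A f = (\<lambda>x. indicator A x *\<^sub>R f x)"

definition Lp :: "real \<Rightarrow> (real ^ 'n) set \<Rightarrow> (real ^ 'n \<Rightarrow> 'k::euclidean_space) set"
  where "Lp p A = {f. f \<in> borel_measurable (lebesgue_on A) \<and>
                      integrable (lebesgue_on A) (\<lambda>x. norm (f x) powr p)}"

definition Lp_norm :: "real \<Rightarrow> (real ^ 'n \<Rightarrow> 'k::euclidean_space) \<Rightarrow> real"
  where "Lp_norm p f = (\<integral>x. norm (f x) powr p \<partial>lebesgue) powr (1 / p)"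

definition avg :: "real \<Rightarrow> (real ^ 'n \<Rightarrow> 'k::euclidean_space) \<Rightarrow> (real ^ 'n) set \<Rightarrow> real"
  where "avg p f Q =
    (1 / measure lebesgue Q * (\<integral>x. norm (f x) powr p \<partial>lebesgue_on Q)) powr (1 / p)"

definition sparse_family :: "real \<Rightarrow> (real ^ 'n) set set \<Rightarrow> bool"
  where "sparse_family \<eta> S \<longleftrightarrow> 0 < \<eta> \<and> \<eta> \<le> 1 \<and> S \<subseteq> cubes \<and>
    (\<exists>E. (\<forall>Q\<in>S. E Q \<in> sets lebesgue \<and> E Q \<subseteq> Q \<and>
                measure lebesgue (E Q) \<ge> \<eta> * measure lebesgue Q) \<and>
         disjoint_family_on E S)"

subsection \<open>Operators\<close>

text \<open>An operator is a function \<open>T\<close> together with a domain \<open>D\<close>; the values of \<open>T\<close> outside \<open>D\<close> are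
  irrelevant. The next predicate says that \<open>D\<close> contains all functions to which \<open>T\<close> is applied in
  the \<open>W_q\<close> condition and in the sharp maximal operator acting on $L^r(\mathbb{R}^n)$; in particular \<open>D\<close> contains
  all compactly supported functions in $L^q(\mathbb{R}^n)$.\<close>
definition operator_domain ::
    "real \<Rightarrow> real \<Rightarrow> real \<Rightarrow> (real ^ 'n \<Rightarrow> 'k::euclidean_space) set \<Rightarrow> bool"
  where "operator_domain q r \<alpha> D \<longleftrightarrow>
    (\<forall>c l f. 0 < l \<longrightarrow> f \<in> Lp q (cube c l) \<longrightarrow> restr (cube c l) f \<in> D) \<and>
    (\<forall>c l f. 0 < l \<longrightarrow> f \<in> Lp r UNIV \<longrightarrow> restr (- cube c (\<alpha> * l)) f \<in> D)"

definition sublinear_on ::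
    "(real ^ 'n \<Rightarrow> 'k) set \<Rightarrow>
     ((real ^ 'n \<Rightarrow> 'k) \<Rightarrow> real ^ 'n \<Rightarrow> 'k::{real_normed_field, euclidean_space}) \<Rightarrow> bool"
  where "sublinear_on D T \<longleftrightarrow>
    (\<forall>f\<in>D. \<forall>g\<in>D. (\<lambda>x. f x + g x) \<in> D \<longrightarrow>
       (AE x in lebesgue. norm (T (\<lambda>x. f x + g x) x) \<le> norm (T f x) + norm (T g x))) \<and>
    (\<forall>f\<in>D. \<forall>a. (\<lambda>x. a * f x) \<in> D \<longrightarrow>
       (AE x in lebesgue. norm (T (\<lambda>x. a * f x) x) = norm a * norm (T f x)))"

text \<open>\<open>\<psi>\<close> only matters on the interval \<open>{0<..<1}\<close>.\<close>
definition W_condition ::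
    "real \<Rightarrow> ((real ^ 'n \<Rightarrow> 'k) \<Rightarrow> real ^ 'n \<Rightarrow> 'k::euclidean_space) \<Rightarrow> (real \<Rightarrow> real) \<Rightarrow> bool"
  where "W_condition q T \<psi> \<longleftrightarrow> antimono_on {0<..<1} \<psi> \<and>
    (\<forall>Q\<in>cubes. \<forall>f\<in>Lp q Q. \<forall>t\<in>{0<..<1}.
       measure lebesgue {x\<in>Q. norm (T (restr Q f) x) > \<psi> t * avg q f Q}
         \<le> t * measure lebesgue Q)"

definition sharp_max ::
    "((real ^ 'n \<Rightarrow> 'k) \<Rightarrow> real ^ 'n \<Rightarrow> 'k::euclidean_space) \<Rightarrow> real \<Rightarrow>
     (real ^ 'n \<Rightarrow> 'k) \<Rightarrow> real ^ 'n \<Rightarrow> ennreal"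
  where "sharp_max T \<alpha> f x =
    (SUP (c, l)\<in>{(c, l). 0 < l \<and> x \<in> cube c l}.
       esssup (lebesgue_on (cube c l) \<Otimes>\<^sub>M lebesgue_on (cube c l))
         (\<lambda>(x', x''). ennreal (norm (T (restr (- cube c (\<alpha> * l)) f) x' -
                                    T (restr (- cube c (\<alpha> * l)) f) x''))))"

subsection \<open>Weak type\<close>

definition weak_Lp_norm :: "real \<Rightarrow> (real ^ 'n \<Rightarrow> ennreal) \<Rightarrow> real"
  where "weak_Lp_norm r F =
    (SUP t\<in>{0<..}. t * measure lebesgue {x. F x > ennreal t} powr (1 / r))"

text \<open>\<open>lmeasurable\<close> includes finiteness of the measure, which rules out the default value \<open>0\<close> of
  \<open>measure\<close> on level sets of infinite measure; \<open>bdd_above\<close> does the same for the real-valued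
  supremum in \<open>weak_Lp_norm\<close>.\<close>
definition weak_Lp :: "real \<Rightarrow> (real ^ 'n \<Rightarrow> ennreal) set"
  where "weak_Lp r = {F \<in> borel_measurable lebesgue.
    (\<forall>t>0. {x. F x > ennreal t} \<in> lmeasurable) \<and>
    bdd_above ((\<lambda>t. t * measure lebesgue {x. F x > ennreal t} powr (1 / r)) ` {0<..})}"

definition weak_type_bound ::
    "real \<Rightarrow> ((real ^ 'n \<Rightarrow> 'k::euclidean_space) \<Rightarrow> real ^ 'n \<Rightarrow> ennreal) \<Rightarrow> real \<Rightarrow> bool"
  where "weak_type_bound r M K \<longleftrightarrow> 0 \<le> K \<and>
    (\<forall>f\<in>Lp r UNIV. M f \<in> weak_Lp r \<and> weak_Lp_norm r (M f) \<le> K * Lp_norm r f)"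

definition weak_type ::
    "real \<Rightarrow> ((real ^ 'n \<Rightarrow> 'k::euclidean_space) \<Rightarrow> real ^ 'n \<Rightarrow> ennreal) \<Rightarrow> bool"
  where "weak_type r M \<longleftrightarrow> (\<exists>K. weak_type_bound r M K)"

definition weak_type_norm ::
    "real \<Rightarrow> ((real ^ 'n \<Rightarrow> 'k::euclidean_space) \<Rightarrow> real ^ 'n \<Rightarrow> ennreal) \<Rightarrow> real"
  where "weak_type_norm r M = Inf {K. weak_type_bound r M K}"

end

theory Submission
  imports Defs
begin

text \<open>Let \<open>E\<close> be the set of points of a cube \<open>Q\<close> where \<open>T(f \<chi>\<^bsub>\<alpha>Q\<^esub>)\<close>, its sharp maximal function or the
  averages of \<open>f\<close> over smaller dilated dyadic cubes exceed a large multiple of \<open>\<langle>f\<rangle>\<^bsub>s,\<alpha>Q\<^esub>\<close>; then \<open>E\<close> is a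
  small part of \<open>Q\<close>, by the \<open>W_q\<close> condition and two weak type bounds. Let \<open>P\<^sub>j\<close> be the
  Calderon--Zygmund cubes of \<open>E\<close>; their total measure is at most \<open>|Q| / 2\<close>. Outside them
  \<open>T(f \<chi>\<^bsub>\<alpha>Q\<^esub>)\<close> is controlled by the average. On \<open>P\<^sub>j\<close> it is at most \<open>|T(f \<chi>\<^bsub>\<alpha>P\<^esub>)|\<close>, with \<open>P = P\<^sub>j\<close>, plus the value
  of the far part \<open>T(f \<chi>\<^bsub>\<alpha>Q - \<alpha>P\<^esub>)\<close>; this oscillates little on \<open>P\<close> and is small at the good points, which
  fill a positive part of \<open>P\<close>. Iterating over the generations of selected cubes, and starting
  from a partition of the space into cubes whose dilates contain the support of \<open>f\<close>, gives a sparse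
  family.\<close>

subsection \<open>Cubes\<close>

text \<open>At a good point sublinearity bounds the far part by |T(f \<chi>)| on \<alpha>Q plus |T(f
  \<chi>)| on \<alpha>P, and the second term is only of the size of the average over \<alpha>P. This
  is why cubes with a large dilated average join the exceptional set: for the remaining ones the
  average over \<alpha>P is comparable with the one over \<alpha>Q. Since the oscillation is an
  essential supremum over pairs, one good point is not enough; the good points must have positive
  measure. They do: \<open>E\<close> fills at most 1/2 of \<open>P\<close>, and the large values of
  T(f \<chi>) on \<alpha>P at most 1/12. The numbers fit as follows. A proportion \<open>lam\<close>
  of \<alpha>Q is |Q| / (12 * 2^n), three such sets make |Q| / 2^(n+2), and selecting at height
  2^(-n-1) multiplies this by 2^(n+1), which leaves |Q| / 2. The sparse family consists of the
  closed dilates \<alpha>P, while the disjoint sets are what the next generation leaves of the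
  half-open \<open>P\<close>: half of \<open>P\<close>, hence the part 1 / (2 \<alpha>^n) of
  \<alpha>P.\<close>

lemma emeasure_UN_le_mult:
  assumes "countable I"
    and X: "\<And>i. i \<in> I \<Longrightarrow> X i \<in> sets M" and Y: "\<And>i. i \<in> I \<Longrightarrow> Y i \<in> sets N"
    and "disjoint_family_on Y I"
    and le: "\<And>i. i \<in> I \<Longrightarrow> emeasure M (X i) \<le> c * emeasure N (Y i)"
  shows "emeasure M (\<Union>i\<in>I. X i) \<le> c * emeasure N (\<Union>i\<in>I. Y i)"
proof -
  have meas: "(\<Union>i\<in>I. X i) \<in> sets M"
    using assms by (intro sets.countable_UN') auto
  \<comment> \<open>The \<open>X i\<close> may overlap, so the indicator of their union is only
    dominated by the sum of the indicators; equality is used for the disjoint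
    \<open>Y i\<close>.\<close>
  have le_sum: "indicator (\<Union>i\<in>I. X i) x \<le> (\<integral>\<^sup>+i. indicator (X i) x \<partial>count_space I)" for x
  proof (cases "x \<in> (\<Union>i\<in>I. X i)")
    case True
    then obtain j where j: "j \<in> I" "x \<in> X j" by auto
    have "(1::ennreal) = (\<integral>\<^sup>+i. indicator {j} i \<partial>count_space I)"
      using j by simp
    also have "\<dots> \<le> (\<integral>\<^sup>+i. indicator (X i) x \<partial>count_space I)"
      using j by (intro nn_integral_mono) (auto simp: indicator_def)
    finally show ?thesis using True by simp
  qed simp
  have "emeasure M (\<Union>i\<in>I. X i) = (\<integral>\<^sup>+x. indicator (\<Union>i\<in>I. X i) x \<partial>M)"
    using meas by simp
  also have "\<dots> \<le> (\<integral>\<^sup>+x. (\<integral>\<^sup>+i. indicator (X i) x \<partial>count_space I) \<partial>M)"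
    by (intro nn_integral_mono le_sum)
  also have "\<dots> = (\<integral>\<^sup>+i. (\<integral>\<^sup>+x. indicator (X i) x \<partial>M) \<partial>count_space I)"
    using \<open>countable I\<close> X by (intro nn_integral_count_space_nn_integral) auto
  also have "\<dots> = (\<integral>\<^sup>+i. emeasure M (X i) \<partial>count_space I)"
    using X by (intro nn_integral_cong) auto
  also have "\<dots> \<le> (\<integral>\<^sup>+i. c * emeasure N (Y i) \<partial>count_space I)"
    using le by (intro nn_integral_mono) auto
  also have "\<dots> = c * emeasure N (\<Union>i\<in>I. Y i)"
    using assms by (simp add: nn_integral_cmult emeasure_UN_countable)
  finally show ?thesis .
qed

lemma mem_cube_iff:
  fixes c :: "real ^ 'n"
  shows "x \<in> cube c l \<longleftrightarrow> (\<forall>i. \<bar>x $ i - c $ i\<bar> \<le> l / 2)"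
proof -
  have "(c - vec (l / 2)) $ i \<le> x $ i \<and> x $ i \<le> (c + vec (l / 2)) $ i \<longleftrightarrow> \<bar>x $ i - c $ i\<bar> \<le> l / 2" for i
    unfolding vector_add_component vector_minus_component vec_component by arith
  then show ?thesis
    unfolding cube_def mem_box_cart by blast
qed

lemma emeasure_cube:
  fixes c :: "real ^ 'n"
  assumes "0 \<le> l"
  shows "emeasure lebesgue (cube c l) = ennreal (l ^ CARD('n))"
proof -
  have "cube c l \<noteq> {}"
    using assms mem_cube_iff[of c c l] by auto
  then have "measure lborel (cube c l) = l ^ CARD('n)"
    unfolding cube_def by (subst content_cbox_cart) auto
  then show ?thesis
    using emeasure_eq_ennreal_measure[of lborel "cube c l"]
    by (simp add: cube_def emeasure_lborel_cbox_eq)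
qed

lemma cube_in_sets_lebesgue [measurable]: "cube c l \<in> sets lebesgue"
  unfolding cube_def by simp

lemma measure_cube:
  fixes c :: "real ^ 'n"
  assumes "0 \<le> l"
  shows "measure lebesgue (cube c l) = l ^ CARD('n)"
  using emeasure_cube[OF assms, of c] assms by (simp add: measure_def)

text \<open>Inclusion puts two opposite corners of one cube into the other, which compares the side
  lengths and, if these agree, forces equal centres. A family is a set of point sets, whereas the
  construction works with pairs, so the pair must be recoverable.\<close>

lemma cube_eq_iff:
  fixes c c' :: "real ^ 'n"
  assumes "0 < l" "0 < l'"
  shows "cube c l = cube c' l' \<longleftrightarrow> c = c' \<and> l = l'"
proof
  assume eq: "cube c l = cube c' l'"
  have *: "l \<le> l' \<and> (l = l' \<longrightarrow> c = c')" if "0 < l" and sub: "cube c l \<subseteq> cube c' l'"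
    for c c' :: "real ^ 'n" and l l' :: real
  proof -
    have "c + vec (l / 2) \<in> cube c l" "c - vec (l / 2) \<in> cube c l"
      using that by (auto simp: mem_cube_iff)
    then have m: "c + vec (l / 2) \<in> cube c' l'" "c - vec (l / 2) \<in> cube c' l'"
      using sub by auto
    have m1: "\<bar>c $ i + l / 2 - c' $ i\<bar> \<le> l' / 2" "\<bar>c $ i - l / 2 - c' $ i\<bar> \<le> l' / 2" for i
      using m by (auto simp: mem_cube_iff)
    have "l \<le> l'"
      using m1(1)[of undefined] m1(2)[of undefined] by linarith
    moreover have "c = c'" if "l = l'"
      unfolding vec_eq_iff
    proof
      fix i show "c $ i = c' $ i"
        using m1[of i] that by linarith
    qed
    ultimately show ?thesis by blast
  qed
  show "c = c' \<and> l = l'"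
    using *[of l c c' l'] *[of l' c' c l] assms eq by auto
qed auto

text \<open>A pair \<open>(a, l)\<close> encodes the half-open cube with lower corner \<open>a\<close> and side length \<open>l\<close>.\<close>
definition hcube :: "(real ^ 'n) \<times> real \<Rightarrow> (real ^ 'n) set"
  where "hcube Q = {x. \<forall>i. fst Q $ i \<le> x $ i \<and> x $ i < fst Q $ i + snd Q}"

definition ctr :: "(real ^ 'n) \<times> real \<Rightarrow> real ^ 'n"
  where "ctr Q = fst Q + vec (snd Q / 2)"

lemma box_subset_hcube: "box (fst Q) (fst Q + vec (snd Q)) \<subseteq> hcube Q"
  by (auto simp: hcube_def mem_box_cart less_imp_le)

lemma cube_ctr: "cube (ctr Q) (snd Q) = cbox (fst Q) (fst Q + vec (snd Q))"
  by (simp add: cube_def ctr_def vec_eq_iff arg_cong2[where f=cbox])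

lemma hcube_subset_cube:
  assumes "1 \<le> \<alpha>" "0 \<le> snd Q"
  shows "hcube Q \<subseteq> cube (ctr Q) (\<alpha> * snd Q)"
proof
  fix x assume "x \<in> hcube Q"
  then have "\<bar>x $ i - ctr Q $ i\<bar> \<le> snd Q / 2" for i
  proof -
    have "fst Q $ i \<le> x $ i" "x $ i < fst Q $ i + snd Q"
      using \<open>x \<in> hcube Q\<close> by (auto simp: hcube_def)
    then show ?thesis
      unfolding ctr_def vector_add_component vec_component by linarith
  qed
  moreover have "snd Q / 2 \<le> \<alpha> * snd Q / 2"
    using assms mult_right_mono[of 1 \<alpha> "snd Q"] by simp
  ultimately show "x \<in> cube (ctr Q) (\<alpha> * snd Q)"
    unfolding mem_cube_iff by (meson order_trans)
qed

lemma hcube_borel: "hcube Q \<in> sets borel"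
proof -
  have "hcube Q = (\<Inter>i. {x. fst Q $ i \<le> x $ i} \<inter> {x. x $ i < fst Q $ i + snd Q})"
    by (auto simp: hcube_def)
  moreover have "closed {x::real^'a. fst Q $ i \<le> x $ i}" for i
    by (intro closed_Collect_le continuous_intros)
  moreover have "open {x::real^'a. x $ i < fst Q $ i + snd Q}" for i
    by (intro open_Collect_less continuous_intros)
  ultimately show ?thesis
    by (auto intro!: sets.finite_INT)
qed

lemma hcube_in_sets_lebesgue [measurable]: "hcube Q \<in> sets lebesgue"
  using hcube_borel[of Q] by (metis sets_completionI_sets sets_lborel)

lemma emeasure_hcube:
  fixes Q :: "(real ^ 'n) \<times> real"
  assumes "0 \<le> snd Q"
  shows "emeasure lebesgue (hcube Q) = ennreal (snd Q ^ CARD('n))"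
proof (rule antisym)
  have "emeasure lebesgue (hcube Q) \<le> emeasure lebesgue (cube (ctr Q) (1 * snd Q))"
    using assms by (intro emeasure_mono hcube_subset_cube) auto
  then show "emeasure lebesgue (hcube Q) \<le> ennreal (snd Q ^ CARD('n))"
    using emeasure_cube[of "snd Q" "ctr Q"] assms by simp
  have "ennreal (snd Q ^ CARD('n)) = emeasure lebesgue (cbox (fst Q) (fst Q + vec (snd Q)))"
    using emeasure_cube[OF assms, of "ctr Q"] by (metis cube_ctr)
  also have "\<dots> = emeasure lebesgue (box (fst Q) (fst Q + vec (snd Q)))"
    by (simp add: emeasure_lborel_box_eq emeasure_lborel_cbox_eq)
  also have "\<dots> \<le> emeasure lebesgue (hcube Q)"
    by (intro emeasure_mono box_subset_hcube) auto
  finally show "ennreal (snd Q ^ CARD('n)) \<le> emeasure lebesgue (hcube Q)" .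
qed

lemma ctr_in_hcube: "0 < snd Q \<Longrightarrow> ctr Q \<in> hcube Q"
  by (auto simp: hcube_def ctr_def)

text \<open>Disjoint sets with nonempty interior are countably many in a separable space.
  Measurability of unions of cubes and statements almost everywhere about all cubes at once rest on
  this.\<close>

lemma countable_disjoint_hcubes:
  assumes "\<And>P. P \<in> F \<Longrightarrow> 0 < snd P" and disj: "disjoint_family_on hcube F"
  shows "countable F"
proof (rule countable_image_inj_on)
  have inj: "P = P'" if "P \<in> F" "P' \<in> F" "x \<in> hcube P" "x \<in> hcube P'" for P P' x
    using disj that by (auto simp: disjoint_family_on_def)
  show "inj_on hcube F"
    using inj assms(1) ctr_in_hcube by (metis inj_onI)
  have "ctr P \<in> box (fst P) (fst P + vec (snd P))" if "P \<in> F" for P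
    using assms(1)[OF that] by (auto simp: ctr_def mem_box_cart)
  then have "interior (hcube P) \<noteq> {}" if "P \<in> F" for P
    using that box_subset_hcube[of P] interior_maximal[OF box_subset_hcube open_box, of P] by blast
  moreover have "pairwise disjnt (hcube ` F)"
    unfolding pairwise_def disjnt_def using inj by blast
  ultimately show "countable (hcube ` F)"
    by (intro countable_disjoint_nonempty_interior_subsets) auto
qed

subsection \<open>Dyadic cubes and stopping\<close>

text \<open>\<open>half x Q\<close> is the dyadic child of \<open>Q\<close> containing \<open>x\<close>; so the dyadic descendants of \<open>Q\<close> are
  described by the paths that the points of \<open>hcube Q\<close> follow down the dyadic tree.\<close>
definition half :: "real ^ 'n \<Rightarrow> (real ^ 'n) \<times> real \<Rightarrow> (real ^ 'n) \<times> real"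
  where "half x Q = (\<chi> i. if x $ i < fst Q $ i + snd Q / 2 then fst Q $ i
     else fst Q $ i + snd Q / 2, snd Q / 2)"

primrec dyadic :: "(real ^ 'n) \<times> real \<Rightarrow> real ^ 'n \<Rightarrow> nat \<Rightarrow> (real ^ 'n) \<times> real"
  where
    "dyadic Q x 0 = Q"
  | "dyadic Q x (Suc k) = half x (dyadic Q x k)"

lemma snd_dyadic: "snd (dyadic Q x k) = snd Q / 2 ^ k"
  by (induction k) (auto simp: half_def)

lemma in_hcube_half: "x \<in> hcube Q \<Longrightarrow> x \<in> hcube (half x Q)"
  unfolding hcube_def half_def
proof safe
  fix i assume "\<forall>i. fst Q $ i \<le> x $ i \<and> x $ i < fst Q $ i + snd Q"
  then have "fst Q $ i \<le> x $ i" "x $ i < fst Q $ i + snd Q / 2 + snd Q / 2"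
    by (auto simp only: add.assoc field_sum_of_halves)
  then show "fst (\<chi> i. if x $ i < fst Q $ i + snd Q / 2 then fst Q $ i
       else fst Q $ i + snd Q / 2, snd Q / 2) $ i \<le> x $ i"
    "x $ i < fst (\<chi> i. if x $ i < fst Q $ i + snd Q / 2 then fst Q $ i
       else fst Q $ i + snd Q / 2, snd Q / 2) $ i +
       snd (\<chi> i. if x $ i < fst Q $ i + snd Q / 2 then fst Q $ i
       else fst Q $ i + snd Q / 2, snd Q / 2)"
    by auto
qed

lemma hcube_half_subset:
  assumes "0 < snd Q" shows "hcube (half x Q) \<subseteq> hcube Q"
proof
  fix y assume y: "y \<in> hcube (half x Q)"
  show "y \<in> hcube Q"
    unfolding hcube_def
  proof safe
    fix i
    have "fst (half x Q) $ i \<le> y $ i \<and> y $ i < fst (half x Q) $ i + snd Q / 2"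
      using y by (auto simp: hcube_def half_def)
    then show "fst Q $ i \<le> y $ i" "y $ i < fst Q $ i + snd Q"
      using assms by (auto simp: half_def split: if_splits)
  qed
qed

lemma half_eq:
  assumes "y \<in> hcube (half x Q)" shows "half y Q = half x Q"
proof -
  have "(y $ i < fst Q $ i + snd Q / 2) = (x $ i < fst Q $ i + snd Q / 2)" for i
    using assms by (auto simp: hcube_def half_def not_less dest!: spec[of _ i] split: if_splits)
  then show ?thesis by (simp add: half_def)
qed

lemma in_hcube_dyadic: "x \<in> hcube Q \<Longrightarrow> x \<in> hcube (dyadic Q x k)"
  by (induction k) (auto intro: in_hcube_half)

lemma hcube_dyadic_Suc_subset: "0 < snd Q \<Longrightarrow> hcube (dyadic Q x (Suc k)) \<subseteq> hcube (dyadic Q x k)"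
  by (simp add: hcube_half_subset snd_dyadic)

lemma hcube_dyadic_subset:
  assumes "0 < snd Q" shows "hcube (dyadic Q x k) \<subseteq> hcube Q"
  by (induction k) (use hcube_dyadic_Suc_subset[OF assms] in auto)

text \<open>\<open>half\<close> depends only on the child that contains the point, so all points of
  a dyadic cube share the path leading to it. Hence two cubes of the same level are equal or
  disjoint.\<close>

lemma dyadic_eq:
  assumes "0 < snd Q" "y \<in> hcube (dyadic Q x k)" shows "dyadic Q y k = dyadic Q x k"
  using assms(2)
proof (induction k)
  case (Suc k)
  then have "y \<in> hcube (dyadic Q x k)"
    using hcube_dyadic_Suc_subset[OF assms(1)] by blast
  then show ?case
    using Suc half_eq by (metis dyadic.simps(2))
qed simp

lemma dyadic_le_eq:
  assumes "0 < snd Q" "y \<in> hcube (dyadic Q x k)" "j \<le> k" shows "dyadic Q y j = dyadic Q x j"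
  using assms(2,3)
proof (induction k)
  case (Suc k)
  then show ?case
    using hcube_dyadic_Suc_subset[OF assms(1)] dyadic_eq[OF assms(1)]
    by (metis (full_types) dyadic_eq[OF assms(1)] le_Suc_eq subsetD)
qed simp

section \<open>Descendants of a cube and stopping rules\<close>

definition descendants :: "(real ^ 'n) \<times> real \<Rightarrow> ((real ^ 'n) \<times> real) set"
  where "descendants Q = {dyadic Q x k | x k. x \<in> hcube Q}"

lemma countable_descendants:
  fixes Q :: "(real ^ 'n) \<times> real"
  assumes "0 < snd Q" shows "countable (descendants Q)"
proof -
  have "countable ((\<lambda>x. dyadic Q x k) ` hcube Q)" for k
  proof (rule countable_disjoint_hcubes)
    show "disjoint_family_on hcube ((\<lambda>x. dyadic Q x k) ` hcube Q)"
    proof -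
      have "dyadic Q x k = dyadic Q x' k" if "y \<in> hcube (dyadic Q x k)" "y \<in> hcube (dyadic Q x' k)" for x x' y
        using dyadic_eq[OF assms] that by metis
      then show ?thesis
        unfolding disjoint_family_on_def by blast
    qed
  qed (use assms in \<open>auto simp: snd_dyadic\<close>)
  moreover have "descendants Q = (\<Union>k. (\<lambda>x. dyadic Q x k) ` hcube Q)"
    by (auto simp: descendants_def)
  ultimately show ?thesis by simp
qed

text \<open>These are the maximal descendants with \<open>B\<close>. The predicate stays arbitrary
  because different rules are needed: high density of a set, or low density inside an open
  set.\<close>

definition stopping :: "(real ^ 'n) \<times> real \<Rightarrow> ((real ^ 'n) \<times> real \<Rightarrow> bool) \<Rightarrow> ((real ^ 'n) \<times> real) set"
  where "stopping Q B = {dyadic Q x k | x k. x \<in> hcube Q \<and> B (dyadic Q x k) \<and>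
      (\<forall>j<k. \<not> B (dyadic Q x j))}"

lemma stopping_subset: "stopping Q B \<subseteq> descendants Q"
  by (auto simp: stopping_def descendants_def)

text \<open>A stopped cube containing \<open>y\<close> is the first cube with \<open>B\<close> on
  the path of \<open>y\<close> itself, since paths agree down to a common cube; the first one is
  unique.\<close>

lemma disjoint_stopping:
  assumes "0 < snd Q"
  shows "disjoint_family_on hcube (stopping Q B)"
proof -
  have "P = P'" if P: "P \<in> stopping Q B" "P' \<in> stopping Q B" "y \<in> hcube P" "y \<in> hcube P'" for P P' y
  proof -
    have first: "\<exists>k. P = dyadic Q y k \<and> B (dyadic Q y k) \<and> (\<forall>j<k. \<not> B (dyadic Q y j))"
      if P: "P \<in> stopping Q B" "y \<in> hcube P" for P
    proof -
      obtain x k where "P = dyadic Q x k" "B (dyadic Q x k)" "\<forall>j<k. \<not> B (dyadic Q x j)"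
        using P by (auto simp: stopping_def)
      moreover have "dyadic Q y j = dyadic Q x j" if "j \<le> k" for j
        using dyadic_le_eq[OF assms _ that] P(2) calculation(1) by blast
      ultimately show ?thesis
        by (metis less_imp_le order_refl)
    qed
    obtain k k' where "P = dyadic Q y k \<and> B (dyadic Q y k) \<and> (\<forall>j<k. \<not> B (dyadic Q y j))"
       "P' = dyadic Q y k' \<and> B (dyadic Q y k') \<and> (\<forall>j<k'. \<not> B (dyadic Q y j))"
      using first P by metis
    then show ?thesis by (metis linorder_neqE_nat)
  qed
  then show ?thesis
    by (auto simp: disjoint_family_on_def)
qed

lemma stopping_covers:
  assumes "x \<in> hcube Q" "B (dyadic Q x k)"
  shows "x \<in> (\<Union>P\<in>stopping Q B. hcube P)"
proof -
  define k0 where "k0 = (LEAST k. B (dyadic Q x k))"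
  have "B (dyadic Q x k0)" "\<forall>j<k0. \<not> B (dyadic Q x j)"
    unfolding k0_def using assms(2) by (auto intro: LeastI dest: not_less_Least)
  then have "dyadic Q x k0 \<in> stopping Q B"
    using assms by (auto simp: stopping_def)
  then show ?thesis
    using in_hcube_dyadic[OF assms(1)] by blast
qed

lemma snd_descendants: "0 < snd Q \<Longrightarrow> P \<in> descendants Q \<Longrightarrow> 0 < snd P"
  by (auto simp: descendants_def snd_dyadic)

lemma hcube_descendants: "0 < snd Q \<Longrightarrow> P \<in> descendants Q \<Longrightarrow> hcube P \<subseteq> hcube Q"
  using hcube_dyadic_subset by (fastforce simp: descendants_def)

text \<open>Passing to a child of a cube of side l moves each coordinate of the centre by l/4, while
  the half side of the dilate drops by \<alpha> l/4; \<open>1 \<le> \<alpha>\<close> makes up for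
  the shift.\<close>

lemma dilate_half_subset:
  assumes "0 < snd Q" "1 \<le> \<alpha>"
  shows "cube (ctr (half x Q)) (\<alpha> * snd (half x Q)) \<subseteq> cube (ctr Q) (\<alpha> * snd Q)"
proof
  fix y assume "y \<in> cube (ctr (half x Q)) (\<alpha> * snd (half x Q))"
  then have y: "\<bar>y $ i - ctr (half x Q) $ i\<bar> \<le> \<alpha> * snd Q / 4" for i
    by (auto simp: mem_cube_iff half_def)
  have d: "\<bar>ctr (half x Q) $ i - ctr Q $ i\<bar> \<le> snd Q / 4" for i
    using assms by (auto simp: ctr_def half_def)
  have "snd Q / 4 \<le> \<alpha> * snd Q / 4"
    using assms mult_right_mono[of 1 \<alpha> "snd Q"] by simp
  then have "\<bar>y $ i - ctr Q $ i\<bar> \<le> \<alpha> * snd Q / 2" for i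
    using y[of i] d[of i] by linarith
  then show "y \<in> cube (ctr Q) (\<alpha> * snd Q)"
    unfolding mem_cube_iff by blast
qed

lemma dilate_descendants_subset:
  assumes "0 < snd Q" "1 \<le> \<alpha>" "P \<in> descendants Q"
  shows "cube (ctr P) (\<alpha> * snd P) \<subseteq> cube (ctr Q) (\<alpha> * snd Q)"
proof -
  have "cube (ctr (dyadic Q x k)) (\<alpha> * snd (dyadic Q x k)) \<subseteq> cube (ctr Q) (\<alpha> * snd Q)" for x k
  proof (induction k)
    case (Suc k)
    then show ?case
      using dilate_half_subset[of "dyadic Q x k" \<alpha> x] assms by (simp add: snd_dyadic)
  qed simp
  then show ?thesis
    using assms(3) by (auto simp: descendants_def)
qed

lemma hcube_subset_ball:
  fixes Q :: "(real ^ 'n) \<times> real"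
  assumes "x \<in> hcube Q" "real CARD('n) * snd Q < e"
  shows "hcube Q \<subseteq> ball x e"
proof
  fix y assume y: "y \<in> hcube Q"
  have "norm (x - y) \<le> (\<Sum>i\<in>UNIV. \<bar>(x - y) $ i\<bar>)"
    by (rule norm_le_l1_cart)
  also have "\<dots> \<le> (\<Sum>i\<in>(UNIV::'n set). snd Q)"
  proof (rule sum_mono)
    fix i
    have "fst Q $ i \<le> x $ i" "x $ i < fst Q $ i + snd Q" "fst Q $ i \<le> y $ i" "y $ i < fst Q $ i + snd Q"
      using assms(1) y by (auto simp: hcube_def)
    then show "\<bar>(x - y) $ i\<bar> \<le> snd Q"
      unfolding vector_minus_component by linarith
  qed
  finally show "y \<in> ball x e"
    using assms(2) by (simp add: dist_norm)
qed

lemma ex_dyadic_subset_open: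
  fixes Q :: "(real ^ 'n) \<times> real"
  assumes "x \<in> hcube Q" "open U" "x \<in> U"
  shows "\<exists>k. hcube (dyadic Q x k) \<subseteq> U"
proof -
  obtain e where "0 < e" and e: "ball x e \<subseteq> U"
    using assms openE by blast
  have "(\<lambda>k. real CARD('n) * (snd Q * (1 / 2) ^ k)) \<longlonglongrightarrow> real CARD('n) * (snd Q * 0)"
    by (intro tendsto_intros) auto
  then have "eventually (\<lambda>k. real CARD('n) * (snd Q * (1 / 2) ^ k) < e) sequentially"
    using \<open>0 < e\<close> by (intro order_tendstoD(2)) auto
  then obtain k where "real CARD('n) * (snd Q * (1 / 2) ^ k) < e"
    by (auto simp: eventually_sequentially)
  then have "hcube (dyadic Q x k) \<subseteq> ball x e"
    by (intro hcube_subset_ball in_hcube_dyadic assms) (simp add: snd_dyadic power_divide)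
  with e show ?thesis by blast
qed

lemma emeasure_hcube_finite: "emeasure lebesgue (hcube Q) < \<infinity>"
proof -
  have "hcube Q \<subseteq> cube (ctr Q) (1 * max 0 (snd Q))"
  proof (cases "0 \<le> snd Q")
    case True
    then show ?thesis using hcube_subset_cube[of 1 Q] by (simp add: max_def)
  next
    case False
    then have "hcube Q = {}"
    proof -
      have "\<not> (fst Q $ i \<le> x $ i \<and> x $ i < fst Q $ i + snd Q)" for x i
        using False by linarith
      then show ?thesis by (auto simp: hcube_def)
    qed
    then show ?thesis by simp
  qed
  then have "emeasure lebesgue (hcube Q) \<le> emeasure lebesgue (cube (ctr Q) (1 * max 0 (snd Q)))"
    by (intro emeasure_mono) auto
  also have "\<dots> < \<infinity>"
    by (subst emeasure_cube) auto
  finally show ?thesis .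
qed

subsection \<open>Density and covering\<close>

text \<open>The Lebesgue density theorem along dyadic cubes: if the points of low density filled a set of
  positive measure, stopping inside a slightly larger open set would contradict \<open>\<theta> < 1\<close>.\<close>
lemma AE_dyadic_density:
  fixes Q :: "(real ^ 'n) \<times> real"
  assumes Q: "0 < snd Q" and E: "E \<in> sets lebesgue" and \<theta>: "0 \<le> \<theta>" "\<theta> < 1"
  shows "AE x in lebesgue. x \<in> hcube Q \<inter> E \<longrightarrow>
    (\<exists>k. ennreal \<theta> * emeasure lebesgue (hcube (dyadic Q x k)) < emeasure lebesgue (hcube (dyadic Q x k) \<inter> E))"
proof -
  define B where "B P \<longleftrightarrow> ennreal \<theta> * emeasure lebesgue (hcube P) < emeasure lebesgue (hcube P \<inter> E)" for P
  define N where "N = hcube Q \<inter> E - (\<Union>P\<in>stopping Q B. hcube P)"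
  have cnt: "countable (stopping Q B')" for B'
    using countable_descendants[OF Q] stopping_subset by (rule countable_subset[rotated])
  have N: "N \<in> sets lebesgue"
    unfolding N_def using E cnt by (intro sets.Diff sets.Int sets.countable_UN') auto
  have Nfin: "emeasure lebesgue N < \<infinity>"
    by (rule order_le_less_trans[OF emeasure_mono emeasure_hcube_finite[of Q]]) (auto simp: N_def)
  have notB: "\<not> B (dyadic Q x k)" if "x \<in> N" for x k
    using stopping_covers[of x Q B k] that by (auto simp: N_def)
  have le: "emeasure lebesgue N \<le> ennreal \<theta> * (emeasure lebesgue N + ennreal e)" if "0 < e" for e
  proof -
    obtain U where U: "open U" "N \<subseteq> U" "U - N \<in> lmeasurable" "emeasure lebesgue (U - N) < ennreal e"
      using sets_lebesgue_outer_open[OF N \<open>0 < e\<close>] .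
    \<comment> \<open>No cube on the path of a point of \<open>N\<close> satisfies \<open>B\<close>,
      so such a path is stopped as soon as its cube fits into \<open>U\<close>. Requiring
      \<open>\<not> B P\<close> in the rule bounds the density of \<open>E\<close> in every stopped
      cube.\<close>
    define F where "F = stopping Q (\<lambda>P. hcube P \<subseteq> U \<and> \<not> B P)"
    have cF: "countable F" unfolding F_def by (rule cnt)
    have FB: "\<not> B P" "hcube P \<subseteq> U" if "P \<in> F" for P
      using that by (auto simp: F_def stopping_def)
    have "N \<subseteq> (\<Union>P\<in>F. hcube P \<inter> E)"
    proof
      fix x assume x: "x \<in> N"
      then have "x \<in> hcube Q" "x \<in> U" "x \<in> E" using U by (auto simp: N_def)
      then obtain k where "hcube (dyadic Q x k) \<subseteq> U"
        using ex_dyadic_subset_open U by blast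
      then have "x \<in> (\<Union>P\<in>F. hcube P)"
        unfolding F_def using \<open>x \<in> hcube Q\<close> notB[OF x]
        by (intro stopping_covers[where k=k]) auto
      then show "x \<in> (\<Union>P\<in>F. hcube P \<inter> E)"
        using \<open>x \<in> E\<close> by auto
    qed
    then have "emeasure lebesgue N \<le> emeasure lebesgue (\<Union>P\<in>F. hcube P \<inter> E)"
      using E cF by (intro emeasure_mono sets.countable_UN') auto
    also have "\<dots> \<le> ennreal \<theta> * emeasure lebesgue (\<Union>P\<in>F. hcube P)"
    proof (rule emeasure_UN_le_mult[OF cF])
      show "disjoint_family_on hcube F"
        unfolding F_def by (rule disjoint_stopping[OF Q])
      show "emeasure lebesgue (hcube P \<inter> E) \<le> ennreal \<theta> * emeasure lebesgue (hcube P)" if "P \<in> F" for P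
        using FB(1)[OF that] by (simp add: B_def not_less)
    qed (use E in auto)
    also have "emeasure lebesgue (\<Union>P\<in>F. hcube P) \<le> emeasure lebesgue U"
      using FB(2) \<open>open U\<close> by (intro emeasure_mono) auto
    also have "emeasure lebesgue U = emeasure lebesgue N + emeasure lebesgue (U - N)"
      using U N plus_emeasure[of N lebesgue "U - N"] by (auto simp: Un_absorb1)
    also have "emeasure lebesgue (U - N) \<le> ennreal e"
      using U by auto
    finally show ?thesis
      by (simp add: add_left_mono mult_left_mono)
  qed
  define m where "m = measure lebesgue N"
  have m: "emeasure lebesgue N = ennreal m" "0 \<le> m"
    using Nfin by (auto simp: m_def emeasure_eq_ennreal_measure)
  have le_m: "m \<le> \<theta> * m + \<theta> * e" if "0 < e" for e
    using le[OF that] that \<theta> m(2) unfolding m(1)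
    by (simp add: ennreal_plus[symmetric] ennreal_mult'[symmetric] distrib_left del: ennreal_plus)
  have m_le: "m \<le> \<theta> * m"
  proof (rule field_le_epsilon)
    fix e :: real assume "0 < e"
    have "m \<le> \<theta> * m + \<theta> * e" using \<open>0 < e\<close> by (rule le_m)
    also have "\<theta> * e \<le> e" using \<theta> \<open>0 < e\<close> by simp
    finally show "m \<le> \<theta> * m + e" by simp
  qed
  have "m = 0"
  proof (rule ccontr)
    assume "m \<noteq> 0"
    then have "\<theta> * m < 1 * m"
      using \<theta> m(2) by (intro mult_strict_right_mono) auto
    with m_le show False by simp
  qed
  then have "N \<in> null_sets lebesgue"
    using m N by auto
  then have "AE x in lebesgue. x \<notin> N"
    by (rule AE_not_in)
  then show ?thesis
  proof eventually_elim
    case (elim x)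
    then show ?case
    proof (intro impI)
      assume "x \<in> hcube Q \<inter> E"
      with elim obtain P where P: "P \<in> stopping Q B" "x \<in> hcube P" by (auto simp: N_def)
      then obtain y k where "P = dyadic Q y k" "B P" by (auto simp: stopping_def)
      then have "B (dyadic Q x k)"
        using dyadic_eq[OF Q] P(2) by metis
      then show "\<exists>k. ennreal \<theta> * emeasure lebesgue (hcube (dyadic Q x k)) < emeasure lebesgue (hcube (dyadic Q x k) \<inter> E)"
        unfolding B_def by blast
    qed
  qed
qed

text \<open>The height is \<open>2\<^sup>-\<^sup>n\<^sup>-\<^sup>1\<close>: the parent of a selected cube \<open>P\<close> was not selected, so \<open>E\<close> fills at most
  half of \<open>P\<close>.\<close>
lemma calderon_zygmund:
  fixes Q :: "(real ^ 'n) \<times> real"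
  assumes Q: "0 < snd Q" and E: "E \<in> sets lebesgue" "E \<subseteq> hcube Q"
    and small: "emeasure lebesgue E \<le> ennreal (1 / 2 ^ (CARD('n) + 2)) * emeasure lebesgue (hcube Q)"
  obtains F where "F \<subseteq> descendants Q" "disjoint_family_on hcube F"
    "emeasure lebesgue (\<Union>P\<in>F. hcube P) \<le> ennreal (1 / 2) * emeasure lebesgue (hcube Q)"
    "AE x in lebesgue. x \<in> E \<longrightarrow> x \<in> (\<Union>P\<in>F. hcube P)"
    "\<And>P. P \<in> F \<Longrightarrow> emeasure lebesgue (hcube P \<inter> E) \<le> ennreal (1 / 2) * emeasure lebesgue (hcube P)"
proof
  let ?n = "CARD('n)"
  define \<theta> :: real where "\<theta> = 1 / 2 ^ (?n + 1)"
  define B where "B P \<longleftrightarrow> ennreal \<theta> * emeasure lebesgue (hcube P) < emeasure lebesgue (hcube P \<inter> E)"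
    for P :: "(real ^ 'n) \<times> real"
  let ?F = "stopping Q B"
  have "(1::real) < 2 ^ (?n + 1)"
    by (rule one_less_power) auto
  then have \<theta>: "0 < \<theta>" "\<theta> < 1" by (auto simp: \<theta>_def)
  have cF: "countable ?F"
    using countable_descendants[OF Q] stopping_subset by (rule countable_subset[rotated])
  show "?F \<subseteq> descendants Q" by (rule stopping_subset)
  show disj: "disjoint_family_on hcube ?F" by (rule disjoint_stopping[OF Q])
  have inv: "ennreal (2 ^ (?n + 1)) * (ennreal \<theta> * y) = y" for y
    using \<theta> by (simp add: mult.assoc[symmetric] ennreal_mult'[symmetric]) (simp add: \<theta>_def)
  have "emeasure lebesgue (\<Union>P\<in>?F. hcube P) \<le> ennreal (2 ^ (?n + 1)) * emeasure lebesgue (\<Union>P\<in>?F. hcube P \<inter> E)"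
  proof (rule emeasure_UN_le_mult[OF cF])
    show "disjoint_family_on (\<lambda>P. hcube P \<inter> E) ?F"
      using disj unfolding disjoint_family_on_def by blast
    fix P assume "P \<in> ?F"
    then have "B P" by (auto simp: stopping_def)
    then have "ennreal (2 ^ (?n + 1)) * (ennreal \<theta> * emeasure lebesgue (hcube P)) \<le> ennreal (2 ^ (?n + 1)) * emeasure lebesgue (hcube P \<inter> E)"
      by (intro mult_left_mono) (auto simp: B_def)
    then show "emeasure lebesgue (hcube P) \<le> ennreal (2 ^ (?n + 1)) * emeasure lebesgue (hcube P \<inter> E)"
      by (simp only: inv)
  qed (use E in auto)
  also have "\<dots> \<le> ennreal (2 ^ (?n + 1)) * (ennreal (1 / 2 ^ (?n + 2)) * emeasure lebesgue (hcube Q))"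
    using E cF by (intro mult_left_mono order_trans[OF emeasure_mono small]) auto
  also have "\<dots> = ennreal (1 / 2) * emeasure lebesgue (hcube Q)"
    by (simp add: mult.assoc[symmetric] ennreal_mult'[symmetric])
  finally show "emeasure lebesgue (\<Union>P\<in>?F. hcube P) \<le> ennreal (1 / 2) * emeasure lebesgue (hcube Q)" .
  show "AE x in lebesgue. x \<in> E \<longrightarrow> x \<in> (\<Union>P\<in>?F. hcube P)"
    using AE_dyadic_density[OF Q E(1) less_imp_le[OF \<theta>(1)] \<theta>(2)]
  proof eventually_elim
    case (elim x)
    then show ?case
      using E(2) stopping_covers[of x Q B] unfolding B_def by blast
  qed
  fix P assume "P \<in> ?F"
  then obtain x k where P: "P = dyadic Q x k" "x \<in> hcube Q" "B (dyadic Q x k)" "\<forall>j<k. \<not> B (dyadic Q x j)"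
    by (auto simp: stopping_def)
  \<comment> \<open>\<open>E\<close> has density at most 2^(-n-2) in \<open>Q\<close>, which is
    below \<open>\<theta>\<close>. So no path stops at level 0, and the selected cube has a parent
    inside \<open>Q\<close>.\<close>
  have "\<not> B Q"
  proof -
    have "emeasure lebesgue (hcube Q \<inter> E) \<le> ennreal (1 / 2 ^ (?n + 2)) * emeasure lebesgue (hcube Q)"
      using small E by (simp add: Int_absorb1)
    also have "\<dots> \<le> ennreal \<theta> * emeasure lebesgue (hcube Q)"
      by (intro mult_right_mono ennreal_leI) (auto simp: \<theta>_def field_simps)
    finally show ?thesis by (simp add: B_def not_less)
  qed
  then have "k \<noteq> 0" using P(3) by (cases k) auto
  then obtain j where k: "k = Suc j" by (cases k) auto
  let ?P' = "dyadic Q x j"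
  have "emeasure lebesgue (hcube P \<inter> E) \<le> emeasure lebesgue (hcube ?P' \<inter> E)"
    using hcube_dyadic_Suc_subset[OF Q, of x j] E by (intro emeasure_mono) (auto simp: P k)
  also have "\<dots> \<le> ennreal \<theta> * emeasure lebesgue (hcube ?P')"
    using P(4) k by (auto simp: B_def not_less)
  also have "emeasure lebesgue (hcube ?P') = ennreal (2 ^ ?n) * emeasure lebesgue (hcube P)"
  proof -
    have sP: "snd ?P' = 2 * snd P" "0 < snd P"
      using Q by (auto simp: P(1) k snd_dyadic half_def)
    have "emeasure lebesgue (hcube ?P') = ennreal ((2 * snd P) ^ ?n)"
      using sP by (subst emeasure_hcube) auto
    moreover have "emeasure lebesgue (hcube P) = ennreal (snd P ^ ?n)"
      using sP by (subst emeasure_hcube) auto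
    ultimately show ?thesis
      by (simp add: power_mult_distrib ennreal_mult')
  qed
  also have "ennreal \<theta> * (ennreal (2 ^ ?n) * emeasure lebesgue (hcube P)) = ennreal (1 / 2) * emeasure lebesgue (hcube P)"
    using \<theta> by (simp add: mult.assoc[symmetric] ennreal_mult'[symmetric]) (simp add: \<theta>_def)
  finally show "emeasure lebesgue (hcube P \<inter> E) \<le> ennreal (1 / 2) * emeasure lebesgue (hcube P)" .
qed

section \<open>Vitali covering for dilates of dyadic cubes\<close>

lemma cube_subset_cball:
  fixes c :: "real ^ 'n"
  shows "cube c l \<subseteq> cball c (real CARD('n) * (l / 2))"
proof
  fix y assume y: "y \<in> cube c l"
  have "norm (y - c) \<le> (\<Sum>i\<in>UNIV. \<bar>(y - c) $ i\<bar>)"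
    by (rule norm_le_l1_cart)
  also have "\<dots> \<le> (\<Sum>i\<in>(UNIV::'n set). l / 2)"
    using y by (intro sum_mono) (auto simp: mem_cube_iff)
  finally show "y \<in> cball c (real CARD('n) * (l / 2))"
    by (simp add: dist_norm norm_minus_commute)
qed

lemma cball_subset_cube: "cball c l \<subseteq> cube c (2 * l)"
proof
  fix y assume "y \<in> cball c l"
  then have "\<bar>(y - c) $ i\<bar> \<le> l" for i
    using component_le_norm_cart[of "y - c" i] by (simp add: dist_norm norm_minus_commute)
  then show "y \<in> cube c (2 * l)" by (simp add: mem_cube_iff)
qed

text \<open>The weak type \<open>(1,1)\<close> bound for the maximal operator over the dilates of dyadic cubes, from
  Vitali's lemma applied to balls containing the dilates.\<close>
lemma emeasure_UN_heavy_le: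
  fixes Q :: "(real ^ 'n) \<times> real"
  assumes Q: "0 < snd Q" and \<alpha>: "1 \<le> \<alpha>" and K: "K \<subseteq> descendants Q"
    and sets: "sets N = sets lebesgue"
    and heavy: "\<And>P. P \<in> K \<Longrightarrow> emeasure lebesgue (cube (ctr P) (\<alpha> * snd P)) \<le> c * emeasure N (cube (ctr P) (\<alpha> * snd P))"
  shows "emeasure lebesgue (\<Union>P\<in>K. hcube P) \<le>
    ennreal ((5 * real CARD('n)) ^ CARD('n)) * c * emeasure N (cube (ctr Q) (\<alpha> * snd Q))"
proof -
  let ?n = "real CARD('n)"
  \<comment> \<open>A ball of radius \<open>r P\<close> contains the dilate, by the l1 bound for the
    norm. The fivefold ball lies in a cube of 5n times the side of the dilate, which produces the
    factor (5n)^n.\<close>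
  define r where "r P = ?n * (\<alpha> * snd P / 2)" for P :: "(real ^ 'n) \<times> real"
  let ?d = "\<lambda>P. cube (ctr P) (\<alpha> * snd P)"
  have pos: "0 < snd P" if "P \<in> K" for P
    using snd_descendants[OF Q] that K by blast
  have "(\<Union>P\<in>K. hcube P) \<subseteq> (\<Union>P\<in>K. cball (ctr P) (r P))"
  proof (rule UN_mono[OF order_refl])
    fix P assume "P \<in> K"
    then show "hcube P \<subseteq> cball (ctr P) (r P)"
      unfolding r_def using hcube_subset_cube[OF \<alpha>] cube_subset_cball pos
      by (meson less_imp_le order_trans)
  qed
  moreover have "0 < r P \<and> r P \<le> r Q" if "P \<in> K" for P
  proof -
    have "0 < snd P" "snd P \<le> snd Q"
      using that K pos Q by (auto simp: descendants_def snd_dyadic divide_le_eq)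
    then show ?thesis using \<alpha> by (auto simp: r_def)
  qed
  ultimately obtain C where C: "countable C" "C \<subseteq> K"
     "pairwise (\<lambda>i j. disjnt (cball (ctr i) (r i)) (cball (ctr j) (r j))) C"
     "(\<Union>P\<in>K. hcube P) \<subseteq> (\<Union>i\<in>C. cball (ctr i) (5 * r i))"
    by (rule Vitali_covering_lemma_cballs)
  have cK: "countable K"
    using countable_descendants[OF Q] K by (rule countable_subset[rotated])
  have "emeasure lebesgue (\<Union>P\<in>K. hcube P) \<le> emeasure lebesgue (\<Union>P\<in>C. cball (ctr P) (5 * r P))"
    using C by (intro emeasure_mono sets.countable_UN') auto
  also have "\<dots> \<le> (ennreal ((5 * ?n) ^ CARD('n)) * c) * emeasure N (\<Union>P\<in>C. ?d P)"
  proof (rule emeasure_UN_le_mult[OF C(1)])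
    show "disjoint_family_on ?d C"
      using C(3) cube_subset_cball unfolding disjoint_family_on_def pairwise_def disjnt_def r_def by blast
    show "emeasure lebesgue (cball (ctr P) (5 * r P)) \<le> ennreal ((5 * ?n) ^ CARD('n)) * c * emeasure N (?d P)"
      if "P \<in> C" for P
    proof -
      have P: "P \<in> K" "0 < snd P" using that C(2) pos by blast+
      have "emeasure lebesgue (cball (ctr P) (5 * r P)) \<le> emeasure lebesgue (cube (ctr P) (2 * (5 * r P)))"
        by (intro emeasure_mono cball_subset_cube) auto
      also have "\<dots> = ennreal ((5 * ?n) ^ CARD('n)) * emeasure lebesgue (?d P)"
      proof -
        have "2 * (5 * r P) = (5 * ?n) * (\<alpha> * snd P)" by (simp add: r_def)
        then show ?thesis
          using P(2) \<alpha> by (simp only: emeasure_cube power_mult_distrib ennreal_mult' mult_nonneg_nonneg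
            zero_le_power of_nat_0_le_iff less_imp_le order_trans[OF zero_le_one] zero_le_numeral)
      qed
      also have "\<dots> \<le> ennreal ((5 * ?n) ^ CARD('n)) * (c * emeasure N (?d P))"
        using heavy[OF P(1)] by (intro mult_left_mono) auto
      finally show ?thesis by (simp add: mult.assoc)
    qed
  qed (auto simp: sets)
  also have "\<dots> \<le> (ennreal ((5 * ?n) ^ CARD('n)) * c) * emeasure N (?d Q)"
  proof (intro mult_left_mono emeasure_mono)
    show "(\<Union>P\<in>C. ?d P) \<subseteq> ?d Q"
      using C(2) K dilate_descendants_subset[OF Q \<alpha>] by blast
  qed (auto simp: sets)
  finally show ?thesis .
qed

subsection \<open>Averages and weak type estimates\<close>

lemma Lp_UNIV_iff:
  "f \<in> Lp p UNIV \<longleftrightarrow> f \<in> borel_measurable lebesgue \<and> integrable lebesgue (\<lambda>x. norm (f x) powr p)"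
  by (simp add: Lp_def lebesgue_on_UNIV_eq)

lemma Lp_subset:
  assumes "f \<in> Lp p UNIV" "A \<in> sets lebesgue"
  shows "f \<in> Lp p A"
proof -
  have "integrable (lebesgue_on A) (\<lambda>x. norm (f x) powr p)"
    using assms integrable_mult_indicator[of A lebesgue "\<lambda>x. norm (f x) powr p"]
    by (subst integrable_restrict_space) (auto simp: Lp_UNIV_iff)
  then show ?thesis
    using assms by (auto simp: Lp_def lebesgue_on_UNIV_eq intro: measurable_restrict_space1)
qed

lemma Lp_mono:
  assumes f: "f \<in> Lp s A" and A: "A \<in> lmeasurable" and qs: "0 < q" "q \<le> s"
  shows "f \<in> Lp q A"
proof -
  have [measurable]: "f \<in> borel_measurable (lebesgue_on A)" using f by (simp add: Lp_def)
  have "integrable (lebesgue_on A) (\<lambda>x. norm (f x) powr q)"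
  proof (rule Bochner_Integration.integrable_bound)
    have "integrable (lebesgue_on A) (\<lambda>x. 1::real)"
      using A integrable_on_const finite_measure.integrable_const finite_measure_lebesgue_on by blast
    then show "integrable (lebesgue_on A) (\<lambda>x. 1 + norm (f x) powr s)"
      using f by (auto simp: Lp_def)
    have "norm (f x) powr q \<le> 1 + norm (f x) powr s" for x
    proof (cases "norm (f x) \<le> 1")
      case True
      then have "norm (f x) powr q \<le> 1" using qs by (simp add: powr_le1)
      then show ?thesis by (simp add: add_increasing2)
    next
      case False
      then have "norm (f x) powr q \<le> norm (f x) powr s" using qs by (intro powr_mono) auto
      then show ?thesis by simp
    qed
    then show "AE x in lebesgue_on A. norm (norm (f x) powr q) \<le> norm (1 + norm (f x) powr s)"
      by auto
  qed simp
  then show ?thesis by (simp add: Lp_def)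
qed

lemma norm_restr_powr:
  "norm (restr A f x) powr p = indicator A x *\<^sub>R (norm (f x) powr p)"
  by (auto simp: restr_def indicator_def)

lemma restr_Lp:
  assumes "f \<in> Lp p A" "A \<in> sets lebesgue"
  shows "restr A f \<in> Lp p UNIV"
proof -
  have "restr A f \<in> borel_measurable lebesgue"
    using assms borel_measurable_restrict_space_iff[of A lebesgue f]
    by (simp add: Lp_def restr_def mult.commute)
  moreover have "integrable lebesgue (\<lambda>x. norm (restr A f x) powr p)"
    unfolding norm_restr_powr using assms
    by (subst integrable_restrict_space[symmetric]) (auto simp: Lp_def)
  ultimately show ?thesis by (simp add: Lp_UNIV_iff)
qed

lemma avg_nonneg [simp]: "0 \<le> avg p f Q"
  by (simp add: avg_def)

lemma integral_norm_powr_eq_avg: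
  assumes "0 < p" "0 < measure lebesgue Q"
  shows "(\<integral>x. norm (f x) powr p \<partial>lebesgue_on Q) = measure lebesgue Q * avg p f Q powr p"
proof -
  have "0 \<le> (\<integral>x. norm (f x) powr p \<partial>lebesgue_on Q)"
    by (intro integral_nonneg_AE) auto
  then show ?thesis
    using assms by (simp add: avg_def powr_powr)
qed

text \<open>The factor \<open>2\<close> comes from using \<open>y\<^sup>q \<le> B\<^sup>q + y\<^sup>s B\<^sup>q\<^sup>-\<^sup>s\<close> in place of Jensen's inequality.\<close>
lemma avg_le_avg:
  assumes f: "f \<in> Lp s A" and A: "A \<in> lmeasurable" "0 < measure lebesgue A" and qs: "1 \<le> q" "q \<le> s"
  shows "avg q f A \<le> 2 * avg s f A"
proof -
  let ?m = "measure lebesgue A" and ?B = "avg s f A"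
  have fq: "f \<in> Lp q A" by (rule Lp_mono[OF f A(1)]) (use qs in auto)
  have int: "integrable (lebesgue_on A) (\<lambda>x. norm (f x) powr s)"
    "integrable (lebesgue_on A) (\<lambda>x. norm (f x) powr q)"
    using f fq by (auto simp: Lp_def)
  have [simp]: "integrable (lebesgue_on A) (\<lambda>x. c::real)" for c
    using A finite_measure.integrable_const finite_measure_lebesgue_on by blast
  have Is: "(\<integral>x. norm (f x) powr s \<partial>lebesgue_on A) = ?m * ?B powr s"
    using qs A by (intro integral_norm_powr_eq_avg) auto
  show ?thesis
  proof (cases "?B = 0")
    case True
    then have "(\<integral>x. norm (f x) powr s \<partial>lebesgue_on A) = 0" using Is by simp
    then have "AE x in lebesgue_on A. norm (f x) powr s = 0"
      using int by (subst (asm) integral_nonneg_eq_0_iff_AE) auto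
    then have "AE x in lebesgue_on A. norm (f x) powr q = 0"
      by eventually_elim auto
    then have "(\<integral>x. norm (f x) powr q \<partial>lebesgue_on A) = 0"
      by (rule integral_eq_zero_AE)
    then show ?thesis using avg_nonneg[of s f A] by (simp add: avg_def)
  next
    case False
    then have B: "0 < ?B" using avg_nonneg[of s f A] by linarith
    have "norm (f x) powr q \<le> ?B powr q + norm (f x) powr s * ?B powr (q - s)" for x
    proof (cases "norm (f x) \<le> ?B")
      case True
      then have "norm (f x) powr q \<le> ?B powr q" using qs by (intro powr_mono2) auto
      then show ?thesis by (simp add: add_increasing2)
    next
      case False
      then have "norm (f x) powr (q - s) \<le> ?B powr (q - s)"
        using qs B by (intro powr_mono2') auto
      then have "norm (f x) powr s * norm (f x) powr (q - s) \<le> norm (f x) powr s * ?B powr (q - s)"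
        by (intro mult_left_mono) auto
      then show ?thesis by (simp add: powr_add[symmetric] add_increasing)
    qed
    then have "(\<integral>x. norm (f x) powr q \<partial>lebesgue_on A) \<le>
        (\<integral>x. ?B powr q + norm (f x) powr s * ?B powr (q - s) \<partial>lebesgue_on A)"
      using int by (intro integral_mono) auto
    also have "\<dots> = ?m * ?B powr q + (?m * ?B powr s) * ?B powr (q - s)"
      using int A Is by (simp add: measure_restrict_space fmeasurableD)
    also have "\<dots> = 2 * (?m * ?B powr q)"
      by (simp add: mult.assoc powr_add[symmetric])
    finally have "1 / ?m * (\<integral>x. norm (f x) powr q \<partial>lebesgue_on A) \<le> 2 * ?B powr q"
      using A by (simp add: field_simps)
    then have "avg q f A \<le> (2 * ?B powr q) powr (1 / q)"
      unfolding avg_def using qs by (intro powr_mono2) (auto intro!: integral_nonneg_AE divide_nonneg_nonneg)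
    also have "\<dots> = 2 powr (1 / q) * ?B"
      using qs B by (simp add: powr_mult powr_powr)
    also have "\<dots> \<le> 2 powr 1 * ?B"
      using qs by (intro mult_right_mono powr_mono) auto
    finally show ?thesis by simp
  qed
qed

lemma Lp_norm_restr:
  assumes "A \<in> sets lebesgue" "0 < p" "0 < measure lebesgue A"
  shows "Lp_norm p (restr A f) = measure lebesgue A powr (1 / p) * avg p f A"
proof -
  have "(\<integral>x. norm (restr A f x) powr p \<partial>lebesgue) = (\<integral>x. norm (f x) powr p \<partial>lebesgue_on A)"
    unfolding norm_restr_powr using assms by (subst integral_restrict_space) auto
  then show ?thesis
    using assms by (simp add: Lp_norm_def integral_norm_powr_eq_avg powr_mult powr_powr)
qed

text \<open>Writes averages through the measure with density |f|^p, the one that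
  \<open>emeasure_UN_heavy_le\<close> compares with Lebesgue measure.\<close>

lemma emeasure_density_Lp:
  assumes "f \<in> Lp p UNIV" "A \<in> sets lebesgue" "0 < p" "0 < measure lebesgue A"
  shows "emeasure (density lebesgue (\<lambda>x. ennreal (norm (f x) powr p))) A =
    ennreal (measure lebesgue A * avg p f A powr p)"
proof -
  have [measurable]: "f \<in> borel_measurable lebesgue" using assms by (simp add: Lp_UNIV_iff)
  have "emeasure (density lebesgue (\<lambda>x. ennreal (norm (f x) powr p))) A =
      (\<integral>\<^sup>+x\<in>A. ennreal (norm (f x) powr p) \<partial>lebesgue)"
    using assms by (subst emeasure_density) auto
  also have "\<dots> = (\<integral>\<^sup>+x. ennreal (norm (f x) powr p) \<partial>lebesgue_on A)"
    using assms by (subst nn_integral_restrict_space) auto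
  also have "\<dots> = ennreal (\<integral>x. norm (f x) powr p \<partial>lebesgue_on A)"
    using Lp_subset[OF assms(1,2)] by (intro nn_integral_eq_integral) (auto simp: Lp_def)
  finally show ?thesis using assms by (simp add: integral_norm_powr_eq_avg)
qed

text \<open>Each cube through \<open>x\<close> competes in the supremum, so the value at one point
  controls the oscillation on the whole cube. Fubini turns the essential bound on pairs into one for
  almost every \<open>x'\<close> and then almost every \<open>x''\<close>.\<close>

lemma sharp_max_oscillation:
  assumes "0 < l" and x: "x \<in> cube c l" and le: "sharp_max T \<alpha> h x \<le> ennreal t" and "0 \<le> t"
    and meas: "T (restr (- cube c (\<alpha> * l)) h) \<in> borel_measurable lebesgue"
  shows "AE x' in lebesgue. x' \<in> cube c l \<longrightarrow> (AE x'' in lebesgue. x'' \<in> cube c l \<longrightarrow>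
    norm (T (restr (- cube c (\<alpha> * l)) h) x' - T (restr (- cube c (\<alpha> * l)) h) x'') \<le> t)"
proof -
  let ?G = "T (restr (- cube c (\<alpha> * l)) h)" and ?M = "lebesgue_on (cube c l)"
  let ?g = "\<lambda>(x', x''). ennreal (norm (?G x' - ?G x''))"
  interpret finite_measure ?M
    by (rule finite_measure_lebesgue_on) (simp add: cube_def)
  interpret pair_sigma_finite ?M ?M ..
  have "esssup (?M \<Otimes>\<^sub>M ?M) ?g \<le> sharp_max T \<alpha> h x"
    unfolding sharp_max_def by (rule SUP_upper2[of "(c, l)"]) (use assms in auto)
  then have "esssup (?M \<Otimes>\<^sub>M ?M) ?g \<le> ennreal t" using le by simp
  moreover have "AE z in ?M \<Otimes>\<^sub>M ?M. ?g z \<le> esssup (?M \<Otimes>\<^sub>M ?M) ?g"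
    by (rule esssup_AE)
  ultimately have "AE z in ?M \<Otimes>\<^sub>M ?M. ?g z \<le> ennreal t"
    by (auto elim: eventually_mono intro: order_trans)
  then have "AE x' in ?M. AE x'' in ?M. ?g (x', x'') \<le> ennreal t"
    by (rule AE_pair)
  then have "AE x' in ?M. AE x'' in ?M. norm (?G x' - ?G x'') \<le> t"
    using \<open>0 \<le> t\<close> by simp
  then show ?thesis
    by (simp add: AE_restrict_space_iff)
qed

text \<open>The infimum is attained: for a function of positive norm divide by the norm, and for
  norm 0 all admissible constants give the same right-hand side.\<close>

lemma weak_type_bound_norm:
  assumes "weak_type r M"
  shows "weak_type_bound r M (weak_type_norm r M)"
proof -
  let ?S = "{K. weak_type_bound r M K}"
  have ne: "?S \<noteq> {}" using assms by (auto simp: weak_type_def)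
  have ge: "0 \<le> K" if "K \<in> ?S" for K using that by (auto simp: weak_type_bound_def)
  have "0 \<le> Inf ?S" by (intro cInf_greatest ne ge)
  moreover have "weak_Lp_norm r (M f) \<le> Inf ?S * Lp_norm r f" if f: "f \<in> Lp r UNIV" for f
  proof (cases "Lp_norm r f = 0")
    case True
    then show ?thesis using ne f by (fastforce simp: weak_type_bound_def)
  next
    case False
    then have pos: "0 < Lp_norm r f" by (simp add: Lp_norm_def)
    have "weak_Lp_norm r (M f) / Lp_norm r f \<le> Inf ?S"
      using f pos by (intro cInf_greatest ne) (auto simp: weak_type_bound_def divide_le_eq)
    then show ?thesis using pos by (simp add: divide_le_eq)
  qed
  moreover have "M f \<in> weak_Lp r" if "f \<in> Lp r UNIV" for f
    using ne that by (auto simp: weak_type_bound_def)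
  ultimately show ?thesis
    by (auto simp: weak_type_bound_def weak_type_norm_def)
qed

lemma weak_type_norm_nonneg: "weak_type r M \<Longrightarrow> 0 \<le> weak_type_norm r M"
  unfolding weak_type_norm_def
  by (rule cInf_greatest) (auto simp: weak_type_def weak_type_bound_def)

text \<open>\<open>V\<close> stands for the measure of a cube and \<open>A\<close> for a bound on
  the average over it. The weak type inequality gives V / c^r, and c \<le> c^r; settling for V / c
  keeps the constants free of \<open>r\<close>.\<close>

lemma weak_type_level_set:
  assumes wt: "weak_type r M" and r: "1 \<le> r" and f: "f \<in> Lp r UNIV"
    and norm: "Lp_norm r f \<le> V powr (1 / r) * A" and "0 \<le> V" "0 \<le> A" and c: "1 \<le> c"
  shows "{x. ennreal (c * weak_type_norm r M * A) < M f x} \<in> sets lebesgue"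
    and "emeasure lebesgue {x. ennreal (c * weak_type_norm r M * A) < M f x} \<le> ennreal (V / c)"
proof -
  let ?N = "weak_type_norm r M"
  have wb: "M f \<in> weak_Lp r" "weak_Lp_norm r (M f) \<le> ?N * Lp_norm r f"
    using weak_type_bound_norm[OF wt] f by (auto simp: weak_type_bound_def)
  have N: "0 \<le> ?N" using wt by (rule weak_type_norm_nonneg)
  have [measurable]: "M f \<in> borel_measurable lebesgue" using wb by (simp add: weak_Lp_def)
  have lm: "{x. ennreal t < M f x} \<in> lmeasurable" if "0 < t" for t
    using wb that by (auto simp: weak_Lp_def)
  show sets: "{x. ennreal (c * ?N * A) < M f x} \<in> sets lebesgue"
    using borel_measurable_less[of "\<lambda>_. ennreal (c * ?N * A)" lebesgue "M f"] by simp
  have level: "t * measure lebesgue {x. ennreal t < M f x} powr (1 / r) \<le> ?N * (V powr (1 / r) * A)" if "0 < t" for t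
  proof -
    have "t * measure lebesgue {x. ennreal t < M f x} powr (1 / r) \<le> weak_Lp_norm r (M f)"
      unfolding weak_Lp_norm_def using wb that by (intro cSUP_upper) (auto simp: weak_Lp_def)
    also have "\<dots> \<le> ?N * Lp_norm r f" by (rule wb)
    also have "\<dots> \<le> ?N * (V powr (1 / r) * A)" using norm N by (rule mult_left_mono)
    finally show ?thesis .
  qed
  show "emeasure lebesgue {x. ennreal (c * ?N * A) < M f x} \<le> ennreal (V / c)"
  \<comment> \<open>The weak type bound says nothing at level 0. If the level is 0, all level sets
    at positive heights are null, and the one at 0 is a countable union of them.\<close>
  proof (cases "?N * A = 0")
    case True
    have null0: "emeasure lebesgue {x. ennreal t < M f x} = 0" if "0 < t" for t
    proof -
      have "t * measure lebesgue {x. ennreal t < M f x} powr (1 / r) \<le> 0"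
        using level[OF that] True by auto
      then have "measure lebesgue {x. ennreal t < M f x} powr (1 / r) \<le> 0"
        using that by (simp add: mult_le_0_iff)
      then have "measure lebesgue {x. ennreal t < M f x} = 0"
        by simp
      then show ?thesis using lm[OF that] by (simp add: emeasure_eq_measure2)
    qed
    then have null: "{x. ennreal (1 / real (Suc k)) < M f x} \<in> null_sets lebesgue" for k
      by (intro null_setsI null0 fmeasurableD lm) auto
    have "{x. ennreal (c * ?N * A) < M f x} \<subseteq> (\<Union>k. {x. ennreal (1 / real (Suc k)) < M f x})"
    proof
      fix x assume "x \<in> {x. ennreal (c * ?N * A) < M f x}"
      then have "0 < M f x" using True by (auto simp: mult.assoc)
      then obtain y where y: "0 < y" "y < M f x" using dense by blast
      then obtain y' where y': "y = ennreal y'" "0 < y'" using y by (cases y) auto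
      then obtain k where "1 / real (Suc k) < y'" using reals_Archimedean[of y'] by (auto simp: inverse_eq_divide)
      then have "ennreal (1 / real (Suc k)) < M f x"
        using y y' by (meson ennreal_leI less_imp_le order_le_less_trans)
      then show "x \<in> (\<Union>k. {x. ennreal (1 / real (Suc k)) < M f x})" by blast
    qed
    moreover have "(\<Union>k. {x. ennreal (1 / real (Suc k)) < M f x}) \<in> null_sets lebesgue"
      using null by (rule null_sets_UN)
    ultimately have "{x. ennreal (c * ?N * A) < M f x} \<in> null_sets lebesgue"
      using null_sets_subset[OF _ sets] by blast
    then have "emeasure lebesgue {x. ennreal (c * ?N * A) < M f x} = 0"
      by (rule null_setsD1)
    then show ?thesis by (simp only: zero_le)
  next
    case False
    then have NA: "0 < ?N * A" using N \<open>0 \<le> A\<close> by simp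
    let ?m = "measure lebesgue {x. ennreal (c * ?N * A) < M f x}"
    have t: "0 < c * ?N * A" using NA c by (simp add: mult.assoc)
    have "(?N * A) * (c * ?m powr (1 / r)) \<le> (?N * A) * V powr (1 / r)"
      using level[OF t] by (simp add: mult_ac)
    then have "c * ?m powr (1 / r) \<le> V powr (1 / r)"
      using NA by (simp only: mult_le_cancel_left_pos)
    then have "(c * ?m powr (1 / r)) powr r \<le> (V powr (1 / r)) powr r"
      using c r by (intro powr_mono2) auto
    then have "c powr r * ?m \<le> V"
      using c r \<open>0 \<le> V\<close> by (simp add: powr_mult powr_powr)
    moreover have "c powr 1 * ?m \<le> c powr r * ?m"
      using c r by (intro mult_right_mono powr_mono) auto
    ultimately have "?m \<le> V / c"
      using c by (simp add: field_simps)
    then show ?thesis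
      using lm[OF t] by (simp add: emeasure_eq_measure2 ennreal_leI)
  qed
qed

subsection \<open>Local domination\<close>

locale sparse_domination =
  fixes q r s \<alpha> :: real
    and D :: "(real ^ 'n \<Rightarrow> 'k::{real_normed_field, euclidean_space}) set"
    and T :: "(real ^ 'n \<Rightarrow> 'k) \<Rightarrow> real ^ 'n \<Rightarrow> 'k" and \<psi> :: "real \<Rightarrow> real"
  assumes q: "1 \<le> q" and r: "1 \<le> r" and s: "s = max q r" and \<alpha>: "3 \<le> \<alpha>"
    and dom: "operator_domain q r \<alpha> D"
    and T_meas: "\<And>f. f \<in> D \<Longrightarrow> T f \<in> borel_measurable lebesgue"
    and sublin: "sublinear_on D T"
    and W: "W_condition q T \<psi>"
    and weak: "weak_type r (sharp_max T \<alpha>)"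
begin

definition dil :: "(real ^ 'n) \<times> real \<Rightarrow> (real ^ 'n) set"
  where "dil Q = cube (ctr Q) (\<alpha> * snd Q)"

definition lam :: real where "lam = 1 / (12 * (2 * \<alpha>) ^ CARD('n))"

definition N :: real where "N = weak_type_norm r (sharp_max T \<alpha>)"

text \<open>With \<open>c2\<close> and \<open>c3\<close>, each of the three exceptional subsets of \<open>Q\<close> below has measure at most
  \<open>|Q| / (12 \<cdot> 2\<^sup>n)\<close>, which leaves \<open>|Q| / 2\<^sup>n\<^sup>+\<^sup>2\<close> for their union.\<close>
definition c2 :: real where "c2 = 12 * (2 * \<alpha>) ^ CARD('n)"

definition c3 :: real where "c3 = (5 * real CARD('n)) ^ CARD('n) * c2"

lemma s_bounds: "1 \<le> s" "q \<le> s" "r \<le> s" "0 < s"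
  using q r s by auto

lemma c2_gt: "1 < c2"
proof -
  have "1 \<le> (2 * \<alpha>) ^ CARD('n)" using \<alpha> by (intro one_le_power) auto
  then show ?thesis unfolding c2_def by linarith
qed

lemma c2_ge: "1 \<le> c2"
  using c2_gt by simp

lemma c3_ge: "1 \<le> c3"
proof -
  have "1 \<le> (5 * real CARD('n)) ^ CARD('n)"
    using zero_less_card_finite[where 'a='n] by (intro one_le_power) linarith
  then have "1 * 1 \<le> c3" unfolding c3_def by (intro mult_mono c2_ge) auto
  then show ?thesis by simp
qed

lemma lam: "0 < lam" "lam < 1" "lam = 1 / c2"
proof -
  show "lam = 1 / c2" by (simp add: lam_def c2_def)
  then show "0 < lam" "lam < 1" using c2_gt by auto
qed

lemma N_nonneg: "0 \<le> N"
  unfolding N_def by (rule weak_type_norm_nonneg[OF weak])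

lemma dil_lmeasurable: "dil Q \<in> lmeasurable"
  unfolding dil_def cube_def by simp

lemma dil_sets [measurable]: "dil Q \<in> sets lebesgue"
  by (rule fmeasurableD[OF dil_lmeasurable])

lemma measure_dil: "0 < snd Q \<Longrightarrow> measure lebesgue (dil Q) = (\<alpha> * snd Q) ^ CARD('n)"
  unfolding dil_def using \<alpha> by (intro measure_cube) auto

lemma measure_dil_pos: "0 < snd Q \<Longrightarrow> 0 < measure lebesgue (dil Q)"
  using \<alpha> by (simp add: measure_dil)

lemma hcube_subset_dil: "0 < snd Q \<Longrightarrow> hcube Q \<subseteq> dil Q"
  unfolding dil_def using \<alpha> by (intro hcube_subset_cube) auto

lemma measure_dil_div_c2:
  "0 < snd Q \<Longrightarrow> ennreal (measure lebesgue (dil Q) / c2) = ennreal (1 / (12 * 2 ^ CARD('n))) * emeasure lebesgue (hcube Q)"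
  using \<alpha> by (subst emeasure_hcube)
    (auto simp: measure_dil c2_def power_mult_distrib ennreal_mult'[symmetric])

lemma Lp_dil:
  assumes "f \<in> Lp s UNIV" "1 \<le> p" "p \<le> s"
  shows "f \<in> Lp p (dil Q)"
  by (rule Lp_mono[OF Lp_subset[OF assms(1) dil_sets] dil_lmeasurable]) (use assms in auto)

lemma restr_dil_in_D:
  assumes "f \<in> Lp s UNIV" "0 < snd Q"
  shows "restr (dil Q) f \<in> D"
proof -
  have "0 < \<alpha> * snd Q" using assms \<alpha> by simp
  then show ?thesis
    using dom Lp_dil[OF assms(1) q s_bounds(2), of Q] unfolding operator_domain_def dil_def by blast
qed

lemma restr_restr_in_D:
  assumes "f \<in> Lp s UNIV" "0 < snd P"
  shows "restr (- dil P) (restr (dil Q) f) \<in> D"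
  using dom restr_Lp[OF Lp_dil[OF assms(1) r s_bounds(3)] dil_sets, of Q] assms(2)
  unfolding operator_domain_def dil_def by blast

lemma W_bound:
  assumes "Q \<in> cubes" "f \<in> Lp q Q"
  shows "measure lebesgue {x\<in>Q. norm (T (restr Q f) x) > \<psi> lam * avg q f Q} \<le> lam * measure lebesgue Q"
proof -
  have "lam \<in> {0<..<1}" using lam by simp
  then show ?thesis
    using W assms unfolding W_condition_def by blast
qed

lemma AE_T_add:
  assumes "f \<in> D" "g \<in> D" "(\<lambda>x. f x + g x) \<in> D"
  shows "AE x in lebesgue. norm (T (\<lambda>x. f x + g x) x) \<le> norm (T f x) + norm (T g x)"
  using sublin assms unfolding sublinear_on_def by blast

lemma AE_T_mult:
  assumes "f \<in> D" "(\<lambda>x. a * f x) \<in> D"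
  shows "AE x in lebesgue. norm (T (\<lambda>x. a * f x) x) = norm a * norm (T f x)"
  using sublin assms unfolding sublinear_on_def by blast

text \<open>With a negative \<open>\<psi> lam\<close> the constant function 1 on a unit cube would
  have the whole cube as exceptional set, against \<open>lam < 1\<close>. The sign is needed to
  replace averages by larger ones.\<close>

lemma \<psi>_nonneg: "0 \<le> \<psi> lam"
proof (rule ccontr)
  assume neg: "\<not> 0 \<le> \<psi> lam"
  let ?Q = "cube 0 1 :: (real ^ 'n) set" and ?f = "\<lambda>_. 1 :: 'k"
  have fin: "finite_measure (lebesgue_on ?Q)"
    by (rule finite_measure_lebesgue_on) (simp add: cube_def)
  have m: "measure lebesgue ?Q = 1" by (simp add: measure_cube)
  have "?f \<in> Lp q ?Q"
    using finite_measure.integrable_const[OF fin] by (simp add: Lp_def)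
  moreover have "?Q \<in> cubes" unfolding cubes_def using zero_less_one by blast
  ultimately have "measure lebesgue {x\<in>?Q. norm (T (restr ?Q ?f) x) > \<psi> lam * avg q ?f ?Q} \<le> lam * measure lebesgue ?Q"
    by (intro W_bound)
  moreover have "avg q ?f ?Q = 1"
    using m by (simp add: avg_def measure_restrict_space)
  then have "{x\<in>?Q. norm (T (restr ?Q ?f) x) > \<psi> lam * avg q ?f ?Q} = ?Q"
    using neg by (auto intro: less_le_trans[OF _ norm_ge_zero])
  ultimately show False using m lam by simp
qed

text \<open>The \<open>W_condition\<close> on the dilate, with \<open>lam\<close> times its measure
  equal to |Q| / (12 * 2^n). The factor 2 is the price for passing from \<open>q\<close>-averages to
  \<open>s\<close>-averages.\<close>

lemma emeasure_large_values:
  assumes f: "f \<in> Lp s UNIV" and Q: "0 < snd Q"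
  defines "E \<equiv> {x \<in> hcube Q. norm (T (restr (dil Q) f) x) > \<psi> lam * (2 * avg s f (dil Q))}"
  shows "E \<in> sets lebesgue"
    and "emeasure lebesgue E \<le> ennreal (1 / (12 * 2 ^ CARD('n))) * emeasure lebesgue (hcube Q)"
proof -
  let ?Tf = "T (restr (dil Q) f)"
  have [measurable]: "?Tf \<in> borel_measurable lebesgue"
    by (rule T_meas[OF restr_dil_in_D[OF f Q]])
  have "hcube Q \<inter> {x \<in> space lebesgue. norm (?Tf x) > \<psi> lam * (2 * avg s f (dil Q))} \<in> sets lebesgue"
    by measurable
  then show "E \<in> sets lebesgue" by (simp add: E_def Int_def)
  let ?E' = "{x \<in> dil Q. norm (?Tf x) > \<psi> lam * avg q f (dil Q)}"
  have "dil Q \<inter> {x \<in> space lebesgue. norm (?Tf x) > \<psi> lam * avg q f (dil Q)} \<in> sets lebesgue"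
    by measurable
  \<comment> \<open>\<open>measure\<close> is 0 by default on sets that are not measurable or have
    infinite measure, so the \<open>W_condition\<close> bounds \<open>emeasure\<close> only once
    this is known.\<close>
  then have E': "?E' \<in> lmeasurable"
    by (intro fmeasurableI2[OF dil_lmeasurable]) (auto simp: Int_def)
  have "0 < \<alpha> * snd Q"
    using \<alpha> Q by simp
  then have "dil Q \<in> cubes"
    unfolding cubes_def dil_def by blast
  moreover have "f \<in> Lp q (dil Q)" by (rule Lp_dil[OF f q s_bounds(2)])
  ultimately have W': "measure lebesgue ?E' \<le> lam * measure lebesgue (dil Q)"
    by (intro W_bound)
  have "avg q f (dil Q) \<le> 2 * avg s f (dil Q)"
    by (rule avg_le_avg[OF Lp_dil[OF f] dil_lmeasurable measure_dil_pos]) (use s_bounds q Q in auto)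
  then have "\<psi> lam * avg q f (dil Q) \<le> \<psi> lam * (2 * avg s f (dil Q))"
    by (intro mult_left_mono \<psi>_nonneg)
  then have "E \<subseteq> ?E'"
    using hcube_subset_dil[OF Q] by (auto simp: E_def)
  then have "emeasure lebesgue E \<le> emeasure lebesgue ?E'"
    using E' by (intro emeasure_mono) auto
  also have "\<dots> = ennreal (measure lebesgue ?E')"
    using E' by (simp add: emeasure_eq_measure2)
  also have "\<dots> \<le> ennreal (measure lebesgue (dil Q) / c2)"
    using W' lam(3) by (intro ennreal_leI) auto
  also have "\<dots> = ennreal (1 / (12 * 2 ^ CARD('n))) * emeasure lebesgue (hcube Q)"
    by (rule measure_dil_div_c2[OF Q])
  finally show "emeasure lebesgue E \<le> ennreal (1 / (12 * 2 ^ CARD('n))) * emeasure lebesgue (hcube Q)" .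
qed

text \<open>The truncation to the dilate has an L^r norm given by the average, so the level
  \<open>c2 * N\<close> times a bound for that average is exceeded on at most 1 / \<open>c2\<close>
  of the measure of the dilate.\<close>

lemma emeasure_large_sharp_max:
  assumes f: "f \<in> Lp s UNIV" and Q: "0 < snd Q"
  defines "E \<equiv> {x \<in> hcube Q. ennreal (c2 * N * (2 * avg s f (dil Q))) < sharp_max T \<alpha> (restr (dil Q) f) x}"
  shows "E \<in> sets lebesgue"
    and "emeasure lebesgue E \<le> ennreal (1 / (12 * 2 ^ CARD('n))) * emeasure lebesgue (hcube Q)"
proof -
  let ?E' = "{x. ennreal (c2 * N * (2 * avg s f (dil Q))) < sharp_max T \<alpha> (restr (dil Q) f) x}"
  have "avg r f (dil Q) \<le> 2 * avg s f (dil Q)"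
    by (rule avg_le_avg[OF Lp_dil[OF f] dil_lmeasurable measure_dil_pos]) (use s_bounds r Q in auto)
  then have "Lp_norm r (restr (dil Q) f) \<le> measure lebesgue (dil Q) powr (1 / r) * (2 * avg s f (dil Q))"
    using r measure_dil_pos[OF Q] by (subst Lp_norm_restr) (auto intro!: mult_left_mono)
  moreover have "restr (dil Q) f \<in> Lp r UNIV"
    by (rule restr_Lp[OF Lp_dil[OF f r s_bounds(3)] dil_sets])
  moreover have "0 \<le> 2 * avg s f (dil Q)" by simp
  ultimately have E': "?E' \<in> sets lebesgue" "emeasure lebesgue ?E' \<le> ennreal (measure lebesgue (dil Q) / c2)"
    unfolding N_def using weak_type_level_set[OF weak r _ _ measure_nonneg _ c2_ge] by blast+
  have E: "E = hcube Q \<inter> ?E'" by (auto simp: E_def)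
  show "E \<in> sets lebesgue" unfolding E using E' by auto
  have "emeasure lebesgue E \<le> emeasure lebesgue ?E'"
    using E' E by (intro emeasure_mono) auto
  also note E'(2)
  also have "ennreal (measure lebesgue (dil Q) / c2) = ennreal (1 / (12 * 2 ^ CARD('n))) * emeasure lebesgue (hcube Q)"
    by (rule measure_dil_div_c2[OF Q])
  finally show "emeasure lebesgue E \<le> ennreal (1 / (12 * 2 ^ CARD('n))) * emeasure lebesgue (hcube Q)" .
qed

lemma dil_descendants_subset:
  assumes "0 < snd Q" "P \<in> descendants Q"
  shows "dil P \<subseteq> dil Q"
  unfolding dil_def using assms \<alpha> by (intro dilate_descendants_subset) auto

text \<open>In a heavy cube the measure with density |f|^s exceeds \<open>c3 * ?A powr s\<close>
  times Lebesgue measure, as c3 \<le> c3^s. The covering lemma loses (5n)^n, the factor by which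
  \<open>c3\<close> was made larger than \<open>c2\<close>.\<close>

lemma emeasure_large_averages:
  assumes f: "f \<in> Lp s UNIV" and Q: "0 < snd Q"
  defines "E \<equiv> (\<Union>P\<in>{P \<in> descendants Q. c3 * avg s f (dil Q) < avg s f (dil P)}. hcube P)"
  shows "E \<in> sets lebesgue"
    and "emeasure lebesgue E \<le> ennreal (1 / (12 * 2 ^ CARD('n))) * emeasure lebesgue (hcube Q)"
proof -
  let ?A = "avg s f (dil Q)" and ?b = "(5 * real CARD('n)) ^ CARD('n)"
  let ?K = "{P \<in> descendants Q. c3 * ?A < avg s f (dil P)}"
  have "countable ?K"
    using countable_descendants[OF Q] by (rule countable_subset[rotated]) auto
  then show "E \<in> sets lebesgue"
    unfolding E_def by (intro sets.countable_UN') auto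
  define \<nu> where "\<nu> = density lebesgue (\<lambda>x. ennreal (norm (f x) powr s))"
  have \<nu>: "emeasure \<nu> (dil P) = ennreal (measure lebesgue (dil P) * avg s f (dil P) powr s)" if "0 < snd P" for P
    unfolding \<nu>_def by (rule emeasure_density_Lp[OF f dil_sets s_bounds(4) measure_dil_pos[OF that]])
  show "emeasure lebesgue E \<le> ennreal (1 / (12 * 2 ^ CARD('n))) * emeasure lebesgue (hcube Q)"
  \<comment> \<open>The comparison constant \<open>c\<close> divides by a power of
    \<open>?A\<close>. If \<open>?A\<close> vanishes, |f|^s has no mass in the dilate of
    \<open>Q\<close> and no cube is heavy.\<close>
  proof (cases "?A = 0")
    case True
    have "avg s f (dil P) = 0" if "P \<in> descendants Q" for P
    proof -
      have P: "0 < snd P" using snd_descendants[OF Q that] .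
      have "emeasure \<nu> (dil P) \<le> emeasure \<nu> (dil Q)"
        using dil_descendants_subset[OF Q that] by (intro emeasure_mono) (auto simp: \<nu>_def)
      then have "measure lebesgue (dil P) * avg s f (dil P) powr s \<le> 0"
        using True by (simp add: \<nu>[OF P] \<nu>[OF Q] ennreal_eq_0_iff)
      then show ?thesis
        using measure_dil_pos[OF P] by (simp add: mult_le_0_iff)
    qed
    then have "?K = {}" using True by auto
    then have "E = {}" unfolding E_def by (simp only: UN_empty)
    then show ?thesis by simp
  next
    case False
    then have A: "0 < ?A" using avg_nonneg[of s f "dil Q"] by linarith
    define c where "c = 1 / (c3 * ?A powr s)"
    have c: "0 < c" using A c3_ge by (auto simp: c_def)
    have "emeasure lebesgue (dil P) \<le> ennreal c * emeasure \<nu> (dil P)" if "P \<in> ?K" for P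
    proof -
      have P: "0 < snd P" using snd_descendants[OF Q] that by auto
      have "c3 * ?A powr s \<le> c3 powr s * ?A powr s"
        using c3_ge s_bounds powr_mono[of 1 s c3] by (intro mult_right_mono) auto
      also have "\<dots> = (c3 * ?A) powr s" using c3_ge by (simp add: powr_mult)
      also have "\<dots> \<le> avg s f (dil P) powr s"
        using that A c3_ge s_bounds by (intro powr_mono2) auto
      finally have "1 \<le> c * avg s f (dil P) powr s"
        using c c3_ge A by (simp add: c_def field_simps)
      then have "measure lebesgue (dil P) * 1 \<le> measure lebesgue (dil P) * (c * avg s f (dil P) powr s)"
        by (intro mult_left_mono) auto
      then have "ennreal (measure lebesgue (dil P)) \<le> ennreal (c * (measure lebesgue (dil P) * avg s f (dil P) powr s))"
        by (intro ennreal_leI) (simp add: mult_ac)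
      then show ?thesis
        using c by (simp add: \<nu>[OF P] ennreal_mult' emeasure_eq_measure2[OF dil_lmeasurable])
    qed
    then have "emeasure lebesgue E \<le> ennreal ?b * ennreal c * emeasure \<nu> (dil Q)"
      unfolding E_def dil_def using Q \<alpha> by (intro emeasure_UN_heavy_le) (auto simp: \<nu>_def)
    also have "\<dots> = ennreal (?b * c * (measure lebesgue (dil Q) * ?A powr s))"
      using c by (simp add: \<nu>[OF Q] ennreal_mult'[symmetric] mult_ac)
    also have "?b * c * (measure lebesgue (dil Q) * ?A powr s) = measure lebesgue (dil Q) / c2"
      using A c2_ge c3_ge by (simp add: c_def c3_def)
    also have "ennreal \<dots> = ennreal (1 / (12 * 2 ^ CARD('n))) * emeasure lebesgue (hcube Q)"
      by (rule measure_dil_div_c2[OF Q])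
    finally show ?thesis .
  qed
qed

text \<open>Sublinearity is used in both directions: the function on \<open>dil Q\<close> is the far
  part plus the one on \<open>dil P\<close>, and the far part is their difference. \<open>t\<close>
  bounds the oscillation of the far part, \<open>u\<close> and \<open>v\<close> the two near terms
  at the good points \<open>G\<close>.\<close>

lemma AE_domination_on_subcube:
  assumes f: "f \<in> Lp s UNIV" and Q: "0 < snd Q" and P: "0 < snd P" "dil P \<subseteq> dil Q"
    and x0: "x0 \<in> hcube P" "sharp_max T \<alpha> (restr (dil Q) f) x0 \<le> ennreal t" "0 \<le> t"
    and G: "\<not> (AE x in lebesgue. x \<notin> G)" "G \<subseteq> hcube P"
    and u: "\<And>x. x \<in> G \<Longrightarrow> norm (T (restr (dil Q) f) x) \<le> u"
    and v: "\<And>x. x \<in> G \<Longrightarrow> norm (T (restr (dil P) f) x) \<le> v"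
  shows "AE x in lebesgue. x \<in> hcube P \<longrightarrow>
    norm (T (restr (dil Q) f) x) \<le> t + u + v + norm (T (restr (dil P) f) x)"
proof -
  let ?Q = "restr (dil Q) f" and ?P = "restr (dil P) f" and ?h = "restr (- dil P) (restr (dil Q) f)"
  have D: "?Q \<in> D" "?P \<in> D" "?h \<in> D"
    using restr_dil_in_D[OF f] restr_restr_in_D[OF f] Q P by auto
  \<comment> \<open>\<open>D\<close> is not assumed to be closed under scalar multiples, so the
    negative of the truncation is obtained as a truncation of \<open>- f\<close>.\<close>
  have "(\<lambda>x. - f x) \<in> Lp s UNIV" using f by (auto simp: Lp_UNIV_iff)
  then have "restr (dil P) (\<lambda>x. - f x) \<in> D" using P by (intro restr_dil_in_D)
  moreover have "restr (dil P) (\<lambda>x. - f x) = (\<lambda>x. - 1 * ?P x)" by (auto simp: restr_def)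
  ultimately have D': "(\<lambda>x. - 1 * ?P x) \<in> D" by simp
  have sum: "?Q = (\<lambda>x. ?h x + ?P x)"
  proof
    show "?Q x = ?h x + ?P x" for x
      using P(2) by (cases "x \<in> dil P"; cases "x \<in> dil Q") (auto simp: restr_def)
  qed
  have sum': "?h = (\<lambda>x. ?Q x + (- 1) * ?P x)"
  proof
    show "?h x = ?Q x + (- 1) * ?P x" for x
      using fun_cong[OF sum, of x] by simp
  qed
  have 1: "AE x in lebesgue. norm (T ?Q x) \<le> norm (T ?h x) + norm (T ?P x)"
  proof -
    have "AE x in lebesgue. norm (T (\<lambda>x. ?h x + ?P x) x) \<le> norm (T ?h x) + norm (T ?P x)"
      by (rule AE_T_add[OF D(3,2)]) (use D(1) sum in argo)
    then show ?thesis by (simp only: sum[symmetric])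
  qed
  have 2: "AE x in lebesgue. norm (T ?h x) \<le> norm (T ?Q x) + norm (T ?P x)"
  proof -
    have "AE x in lebesgue. norm (T (\<lambda>x. ?Q x + (- 1) * ?P x) x) \<le> norm (T ?Q x) + norm (T (\<lambda>x. - 1 * ?P x) x)"
      by (rule AE_T_add[OF D(1) D']) (use D(3) sum' in argo)
    moreover have "AE x in lebesgue. norm (T (\<lambda>x. - 1 * ?P x) x) = norm (- 1 :: 'k) * norm (T ?P x)"
      by (rule AE_T_mult[OF D(2) D'])
    ultimately show ?thesis
      unfolding sum'[symmetric] by eventually_elim simp
  qed
  have PC: "hcube P \<subseteq> cube (ctr P) (snd P)" using hcube_subset_cube[of 1 P] P by simp
  have 3: "AE x in lebesgue. x \<in> cube (ctr P) (snd P) \<longrightarrow> (AE y in lebesgue. y \<in> cube (ctr P) (snd P) \<longrightarrow>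
      norm (T ?h x - T ?h y) \<le> t)"
    using sharp_max_oscillation[OF P(1), of x0 "ctr P" T \<alpha> ?Q t] x0 PC T_meas[OF D(3)]
    unfolding dil_def by blast
  from 1 3 show ?thesis
  proof eventually_elim
    case (elim x)
    show ?case
    proof
      assume "x \<in> hcube P"
      then have "AE y in lebesgue. y \<in> cube (ctr P) (snd P) \<longrightarrow> norm (T ?h x - T ?h y) \<le> t"
        using elim PC by auto
      with 2 have "AE y in lebesgue. y \<in> cube (ctr P) (snd P) \<longrightarrow>
          norm (T ?h x - T ?h y) \<le> t \<and> norm (T ?h y) \<le> norm (T ?Q y) + norm (T ?P y)"
        by eventually_elim auto
      then have AE_G: "AE y in lebesgue. y \<in> G \<longrightarrow>
          norm (T ?h x - T ?h y) \<le> t \<and> norm (T ?h y) \<le> norm (T ?Q y) + norm (T ?P y)"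
        by (rule eventually_mono) (use G(2) PC in blast)
      \<comment> \<open>The null set of bad \<open>y\<close> depends on \<open>x\<close>; as
        \<open>G\<close> is not null, it contains a point outside.\<close>
      have "\<exists>y\<in>G. norm (T ?h x - T ?h y) \<le> t \<and> norm (T ?h y) \<le> norm (T ?Q y) + norm (T ?P y)"
      proof (rule ccontr)
        assume neg: "\<not> ?thesis"
        have "AE y in lebesgue. y \<notin> G"
          using AE_G by (rule eventually_mono) (use neg in blast)
        with G(1) show False ..
      qed
      then obtain y where y: "y \<in> G" "norm (T ?h x - T ?h y) \<le> t" "norm (T ?h y) \<le> norm (T ?Q y) + norm (T ?P y)"
        by blast
      have "norm (T ?h x) \<le> norm (T ?h x - T ?h y) + norm (T ?h y)"
        using norm_triangle_sub[of "T ?h x" "T ?h y"] by simp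
      then have "norm (T ?h x) \<le> t + u + v"
        using y u[OF y(1)] v[OF y(1)] by linarith
      then show "norm (T ?Q x) \<le> t + u + v + norm (T ?P x)"
        using elim(1) by linarith
    qed
  qed
qed

text \<open>The summands belong to the oscillation of the far part (\<open>c2\<close>), to T on
  \<open>dil Q\<close> (1) and to T on \<open>dil P\<close> (\<open>c3\<close>, the ratio of the
  averages); the factor 2 comes from \<open>avg_le_avg\<close>.\<close>

definition C0 :: real where "C0 = 2 * (c2 + 1 + c3)"

lemma local_domination:
  assumes f: "f \<in> Lp s UNIV" and Q: "0 < snd Q"
  shows "\<exists>F. F \<subseteq> descendants Q \<and> disjoint_family_on hcube F \<and>
    emeasure lebesgue (\<Union>P\<in>F. hcube P) \<le> ennreal (1 / 2) * emeasure lebesgue (hcube Q) \<and>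
    (AE x in lebesgue. x \<in> hcube Q \<longrightarrow> x \<notin> (\<Union>P\<in>F. hcube P) \<longrightarrow>
      norm (T (restr (dil Q) f) x) \<le> C0 * (\<psi> lam + N) * avg s f (dil Q)) \<and>
    (AE x in lebesgue. \<forall>P\<in>F. x \<in> hcube P \<longrightarrow>
      norm (T (restr (dil Q) f) x) \<le> C0 * (\<psi> lam + N) * avg s f (dil Q) + norm (T (restr (dil P) f) x))"
proof -
  let ?A = "avg s f (dil Q)" and ?n = "CARD('n)"
  let ?\<epsilon> = "ennreal (1 / (12 * 2 ^ ?n))"
  define E1 where "E1 = {x \<in> hcube Q. norm (T (restr (dil Q) f) x) > \<psi> lam * (2 * ?A)}"
  define E2 where "E2 = {x \<in> hcube Q. ennreal (c2 * N * (2 * ?A)) < sharp_max T \<alpha> (restr (dil Q) f) x}"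
  define E3 where "E3 = (\<Union>P\<in>{P \<in> descendants Q. c3 * ?A < avg s f (dil P)}. hcube P)"
  define E where "E = E1 \<union> E2 \<union> E3"
  note E1 = emeasure_large_values[OF f Q, folded E1_def]
  note E2 = emeasure_large_sharp_max[OF f Q, folded E2_def]
  note E3 = emeasure_large_averages[OF f Q, folded E3_def]
  have E: "E \<in> sets lebesgue" using E1(1) E2(1) E3(1) by (auto simp: E_def)
  have E_sub: "E \<subseteq> hcube Q"
    using hcube_descendants[OF Q] by (auto simp: E_def E1_def E2_def E3_def)
  have "emeasure lebesgue E \<le> emeasure lebesgue (E1 \<union> E2) + emeasure lebesgue E3"
    unfolding E_def using E1 E2 E3 by (intro emeasure_subadditive) auto
  also have "\<dots> \<le> (emeasure lebesgue E1 + emeasure lebesgue E2) + emeasure lebesgue E3"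
    using E1 E2 by (intro add_right_mono emeasure_subadditive) auto
  also have "\<dots> \<le> (?\<epsilon> * emeasure lebesgue (hcube Q) + ?\<epsilon> * emeasure lebesgue (hcube Q)) + ?\<epsilon> * emeasure lebesgue (hcube Q)"
    by (intro add_mono E1 E2 E3)
  also have "\<dots> = (?\<epsilon> + ?\<epsilon> + ?\<epsilon>) * emeasure lebesgue (hcube Q)"
    by (simp add: distrib_right)
  also have "?\<epsilon> + ?\<epsilon> + ?\<epsilon> = ennreal (1 / 2 ^ (?n + 2))"
    by (simp add: ennreal_plus[symmetric] del: ennreal_plus)
  finally have small: "emeasure lebesgue E \<le> ennreal (1 / 2 ^ (?n + 2)) * emeasure lebesgue (hcube Q)" .
  obtain F where F: "F \<subseteq> descendants Q" "disjoint_family_on hcube F"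
    "emeasure lebesgue (\<Union>P\<in>F. hcube P) \<le> ennreal (1 / 2) * emeasure lebesgue (hcube Q)"
    "AE x in lebesgue. x \<in> E \<longrightarrow> x \<in> (\<Union>P\<in>F. hcube P)"
    "\<And>P. P \<in> F \<Longrightarrow> emeasure lebesgue (hcube P \<inter> E) \<le> ennreal (1 / 2) * emeasure lebesgue (hcube P)"
    using calderon_zygmund[OF Q E E_sub small] by blast
  have A: "0 \<le> ?A" by simp
  \<comment> \<open>Keeps the arithmetic linear: \<open>a\<close> and \<open>a'\<close> stand for
    \<open>\<psi> lam * ?A\<close> and \<open>N * ?A\<close>, the letters \<open>b\<close> and
    \<open>d\<close> for their multiples by \<open>c2\<close> and \<open>c3\<close>, as in the
    expansion \<open>C\<close> below.\<close>
  have lin: "2 * a \<le> 2 * (b + a + d) + 2 * (b' + a' + d')"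
    "t \<le> 2 * d \<Longrightarrow> 2 * b' + 2 * a + t \<le> 2 * (b + a + d) + 2 * (b' + a' + d')"
    if "0 \<le> a" "0 \<le> a'" "0 \<le> b" "0 \<le> b'" "0 \<le> d" "0 \<le> d'" for a b d a' b' d' t :: real
    using that by auto
  have nn: "0 \<le> \<psi> lam * ?A" "0 \<le> N * ?A" "0 \<le> c2 * (\<psi> lam * ?A)" "0 \<le> c2 * (N * ?A)" "0 \<le> c3 * (\<psi> lam * ?A)" "0 \<le> c3 * (N * ?A)"
    using \<psi>_nonneg N_nonneg A c2_ge c3_ge by auto
  have C: "C0 * (\<psi> lam + N) * ?A = 2 * (c2 * (\<psi> lam * ?A) + \<psi> lam * ?A + c3 * (\<psi> lam * ?A))
      + 2 * (c2 * (N * ?A) + N * ?A + c3 * (N * ?A))"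
    by (simp add: C0_def algebra_simps)
  have "AE x in lebesgue. x \<in> hcube Q \<longrightarrow> x \<notin> (\<Union>P\<in>F. hcube P) \<longrightarrow>
      norm (T (restr (dil Q) f) x) \<le> C0 * (\<psi> lam + N) * ?A"
    using F(4)
  proof eventually_elim
    case (elim x)
    show ?case
    proof (intro impI)
      assume "x \<in> hcube Q" "x \<notin> (\<Union>P\<in>F. hcube P)"
      then have "norm (T (restr (dil Q) f) x) \<le> \<psi> lam * (2 * ?A)"
        using elim by (auto simp: E_def E1_def not_less)
      also have "\<dots> = 2 * (\<psi> lam * ?A)" by simp
      also have "\<dots> \<le> C0 * (\<psi> lam + N) * ?A"
        unfolding C by (rule lin(1)[OF nn])
      finally show "norm (T (restr (dil Q) f) x) \<le> C0 * (\<psi> lam + N) * ?A" .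
    qed
  qed
  moreover have "AE x in lebesgue. x \<in> hcube P \<longrightarrow>
      norm (T (restr (dil Q) f) x) \<le> C0 * (\<psi> lam + N) * ?A + norm (T (restr (dil P) f) x)" if PF: "P \<in> F" for P
  proof -
    have Pd: "P \<in> descendants Q" and P: "0 < snd P"
      using PF F(1) snd_descendants[OF Q] by blast+
    have pos: "0 < emeasure lebesgue (hcube P)" using P by (subst emeasure_hcube) auto
    \<comment> \<open>\<open>E\<close> controls T only for the truncation to \<open>dil Q\<close>;
      the truncation to \<open>dil P\<close> needs its own exceptional set inside
      \<open>P\<close>.\<close>
    define E4 where "E4 = {x \<in> hcube P. norm (T (restr (dil P) f) x) > \<psi> lam * (2 * avg s f (dil P))}"
    note E4 = emeasure_large_values[OF f P, folded E4_def]
    define G where "G = hcube P - (E \<union> E4)"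
    have Gs: "G \<in> sets lebesgue" unfolding G_def using E E4 by auto
    \<comment> \<open>\<open>E\<close> takes at most 1/2 of \<open>P\<close> and \<open>E4\<close>
      at most 1 / (12 * 2^n), together less than all of it.\<close>
    have "\<not> (AE x in lebesgue. x \<notin> G)"
    proof
      assume "AE x in lebesgue. x \<notin> G"
      then have "emeasure lebesgue G = 0"
        using Gs AE_iff_measurable[OF Gs, of "\<lambda>x. x \<notin> G"] by simp
      moreover have "emeasure lebesgue (hcube P) \<le> emeasure lebesgue (G \<union> ((hcube P \<inter> E) \<union> E4))"
        using Gs E E4 by (intro emeasure_mono) (auto simp: G_def)
      moreover have "emeasure lebesgue (G \<union> ((hcube P \<inter> E) \<union> E4)) \<le> emeasure lebesgue G + emeasure lebesgue ((hcube P \<inter> E) \<union> E4)"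
        using Gs E E4 by (intro emeasure_subadditive) auto
      moreover have "emeasure lebesgue ((hcube P \<inter> E) \<union> E4) \<le> emeasure lebesgue (hcube P \<inter> E) + emeasure lebesgue E4"
        using E E4 by (intro emeasure_subadditive) auto
      moreover have "emeasure lebesgue (hcube P \<inter> E) + emeasure lebesgue E4 \<le>
          ennreal (1 / 2) * emeasure lebesgue (hcube P) + ?\<epsilon> * emeasure lebesgue (hcube P)"
        by (intro add_mono F(5) PF E4)
      ultimately have "emeasure lebesgue (hcube P) \<le> ennreal (1 / 2) * emeasure lebesgue (hcube P) + ?\<epsilon> * emeasure lebesgue (hcube P)"
        by (auto intro: order_trans)
      also have "\<dots> = ennreal (1 / 2 + 1 / (12 * 2 ^ ?n)) * emeasure lebesgue (hcube P)"
        by (subst ennreal_plus) (auto simp: distrib_right)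
      also have "\<dots> = ennreal ((1 / 2 + 1 / (12 * 2 ^ ?n)) * snd P ^ ?n)"
      proof -
        have "emeasure lebesgue (hcube P) = ennreal (snd P ^ ?n)"
          using P by (intro emeasure_hcube) auto
        then show ?thesis
          using ennreal_mult'[of "1 / 2 + 1 / (12 * 2 ^ ?n)" "snd P ^ ?n"] by (simp only:) simp
      qed
      also have "emeasure lebesgue (hcube P) = ennreal (snd P ^ ?n)"
        using P by (intro emeasure_hcube) auto
      finally have "snd P ^ ?n \<le> (1 / 2 + 1 / (12 * 2 ^ ?n)) * snd P ^ ?n"
        using P by (subst (asm) ennreal_le_iff) auto
      moreover have "(1 / 2 + 1 / (12 * 2 ^ ?n)) * snd P ^ ?n < 1 * snd P ^ ?n"
      proof (rule mult_strict_right_mono)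
        have "(1::real) \<le> 2 ^ ?n" by (rule one_le_power) simp
        then have "1 / (12 * 2 ^ ?n) \<le> 1 / (12 * (1::real))"
          by (intro divide_left_mono mult_left_mono) auto
        then show "1 / 2 + 1 / (12 * 2 ^ ?n) < (1::real)" by linarith
      qed (use P in simp)
      ultimately show False by simp
    qed
    note G = this
    then obtain x0 where x0: "x0 \<in> G" by fastforce
    \<comment> \<open>A heavy \<open>P\<close> would be contained in \<open>E3\<close>, leaving no
      point for \<open>G\<close>.\<close>
    have "P \<notin> {P \<in> descendants Q. c3 * ?A < avg s f (dil P)}"
      using x0 unfolding G_def E_def E3_def by blast
    then have AP: "avg s f (dil P) \<le> c3 * ?A" using Pd by auto
    have "AE x in lebesgue. x \<in> hcube P \<longrightarrow>
      norm (T (restr (dil Q) f) x) \<le> c2 * N * (2 * ?A) + \<psi> lam * (2 * ?A) + \<psi> lam * (2 * avg s f (dil P)) + norm (T (restr (dil P) f) x)"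
    proof (rule AE_domination_on_subcube[OF f Q P dil_descendants_subset[OF Q Pd] _ _ _ G])
      have PQ: "hcube P \<subseteq> hcube Q" by (rule hcube_descendants[OF Q Pd])
      show "x0 \<in> hcube P" "G \<subseteq> hcube P" using x0 by (auto simp: G_def)
      show "sharp_max T \<alpha> (restr (dil Q) f) x0 \<le> ennreal (c2 * N * (2 * ?A))"
        using x0 PQ by (auto simp: G_def E_def E2_def not_less)
      show "0 \<le> c2 * N * (2 * ?A)" using c2_ge N_nonneg by simp
      show "norm (T (restr (dil Q) f) x) \<le> \<psi> lam * (2 * ?A)" if "x \<in> G" for x
        using that PQ by (auto simp: G_def E_def E1_def not_less)
      show "norm (T (restr (dil P) f) x) \<le> \<psi> lam * (2 * avg s f (dil P))" if "x \<in> G" for x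
        using that by (auto simp: G_def E4_def not_less)
    qed
    moreover have "c2 * N * (2 * ?A) + \<psi> lam * (2 * ?A) + \<psi> lam * (2 * avg s f (dil P)) \<le> C0 * (\<psi> lam + N) * ?A"
    proof -
      have "\<psi> lam * (2 * avg s f (dil P)) \<le> \<psi> lam * (2 * (c3 * ?A))"
        using AP \<psi>_nonneg by (intro mult_left_mono) auto
      also have "\<dots> = 2 * (c3 * (\<psi> lam * ?A))" by simp
      finally have a: "\<psi> lam * (2 * avg s f (dil P)) \<le> 2 * (c3 * (\<psi> lam * ?A))" .
      have b: "c2 * N * (2 * ?A) = 2 * (c2 * (N * ?A))" "\<psi> lam * (2 * ?A) = 2 * (\<psi> lam * ?A)" by simp_all
      show ?thesis unfolding C b by (rule lin(2)[OF nn a])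
    qed
    ultimately show ?thesis
      by (auto elim: eventually_mono)
  qed
  moreover have "countable F"
    using countable_descendants[OF Q] F(1) by (rule countable_subset[rotated])
  ultimately show ?thesis
    using F by (intro exI[of _ F]) (auto simp: AE_ball_countable)
qed

end

subsection \<open>Iteration\<close>

locale sparse_children =
  fixes ch :: "(real ^ 'n) \<times> real \<Rightarrow> ((real ^ 'n) \<times> real) set"
  assumes ch_subset: "0 < snd Q \<Longrightarrow> ch Q \<subseteq> descendants Q"
    and ch_disjoint: "0 < snd Q \<Longrightarrow> disjoint_family_on hcube (ch Q)"
    and ch_half: "0 < snd Q \<Longrightarrow>
      emeasure lebesgue (\<Union>P\<in>ch Q. hcube P) \<le> ennreal (1 / 2) * emeasure lebesgue (hcube Q)"
begin

primrec gen :: "(real ^ 'n) \<times> real \<Rightarrow> nat \<Rightarrow> ((real ^ 'n) \<times> real) set"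
  where
    "gen R 0 = {R}"
  | "gen R (Suc k) = (\<Union>P\<in>gen R k. ch P)"

text \<open>The cores are the disjoint sets that will witness sparseness.\<close>

definition core :: "(real ^ 'n) \<times> real \<Rightarrow> (real ^ 'n) set"
  where "core P = hcube P - (\<Union>P'\<in>ch P. hcube P')"

lemma ch_props:
  assumes "0 < snd P" "P' \<in> ch P"
  shows "0 < snd P'" "hcube P' \<subseteq> hcube P"
  using ch_subset[OF assms(1)] assms snd_descendants hcube_descendants by blast+

lemma countable_ch: "0 < snd P \<Longrightarrow> countable (ch P)"
  by (rule countable_subset[OF ch_subset countable_descendants])

lemma snd_gen:
  assumes "0 < snd R" "P \<in> gen R k" shows "0 < snd P"
  using assms(2)
proof (induction k arbitrary: P)
  case (Suc k)
  then obtain P1 where "P1 \<in> gen R k" "P \<in> ch P1" by auto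
  then show ?case using Suc.IH ch_props(1) by blast
qed (use assms in simp)

lemma countable_gen:
  assumes "0 < snd R" shows "countable (gen R k)"
proof (induction k)
  case (Suc k)
  then show ?case
    using countable_ch[OF snd_gen[OF assms]] by auto
qed simp

lemma UN_gen_Suc_subset:
  assumes "0 < snd R" shows "(\<Union>P\<in>gen R (Suc k). hcube P) \<subseteq> (\<Union>P\<in>gen R k. hcube P)"
  using ch_props(2)[OF snd_gen[OF assms]] by fastforce

lemma UN_gen_antimono:
  assumes "0 < snd R" "j \<le> k" shows "(\<Union>P\<in>gen R k. hcube P) \<subseteq> (\<Union>P\<in>gen R j. hcube P)"
  using assms(2)
proof (induction k rule: dec_induct)
  case (step k)
  then show ?case using UN_gen_Suc_subset[OF assms(1), of k] by blast
qed simp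

lemma hcube_gen_subset:
  assumes "0 < snd R" "P \<in> gen R k" shows "hcube P \<subseteq> hcube R"
  using UN_gen_antimono[OF assms(1), of 0 k] assms(2) by auto

lemma disjoint_gen:
  assumes R: "0 < snd R"
  shows "disjoint_family_on hcube (gen R k)"
proof -
  have "P = P'" if "P \<in> gen R k" "P' \<in> gen R k" "x \<in> hcube P" "x \<in> hcube P'" for P P' x
    using that
  proof (induction k arbitrary: P P')
    case (Suc k)
    from Suc.prems obtain P1 P1' where *: "P1 \<in> gen R k" "P \<in> ch P1" "P1' \<in> gen R k" "P' \<in> ch P1'"
      by auto
    then have pos: "0 < snd P1" "0 < snd P1'" using snd_gen[OF R] by auto
    have "P1 = P1'"
      using Suc.IH * Suc.prems(3,4) ch_props(2) pos by blast
    then show ?case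
      using ch_disjoint[OF pos(1)] * Suc.prems(3,4) unfolding disjoint_family_on_def by blast
  qed simp
  then show ?thesis unfolding disjoint_family_on_def by blast
qed

lemma emeasure_UN_gen:
  assumes R: "0 < snd R"
  shows "emeasure lebesgue (\<Union>P\<in>gen R k. hcube P) \<le> ennreal ((1 / 2) ^ k) * emeasure lebesgue (hcube R)"
proof (induction k)
  case (Suc k)
  have "(\<Union>P\<in>gen R (Suc k). hcube P) = (\<Union>P\<in>gen R k. \<Union>P'\<in>ch P. hcube P')" by auto
  also have "emeasure lebesgue \<dots> \<le> ennreal (1 / 2) * emeasure lebesgue (\<Union>P\<in>gen R k. hcube P)"
  proof (rule emeasure_UN_le_mult[OF countable_gen[OF R] _ _ disjoint_gen[OF R]])
    fix P assume "P \<in> gen R k"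
    then have P: "0 < snd P" by (rule snd_gen[OF R])
    show "(\<Union>P'\<in>ch P. hcube P') \<in> sets lebesgue"
      using countable_ch[OF P] by (intro sets.countable_UN') auto
    show "emeasure lebesgue (\<Union>P'\<in>ch P. hcube P') \<le> ennreal (1 / 2) * emeasure lebesgue (hcube P)"
      by (rule ch_half[OF P])
  qed simp
  also have "\<dots> \<le> ennreal (1 / 2) * (ennreal ((1 / 2) ^ k) * emeasure lebesgue (hcube R))"
    by (intro mult_left_mono Suc.IH) simp
  also have "\<dots> = ennreal ((1 / 2) ^ Suc k) * emeasure lebesgue (hcube R)"
    by (subst power_Suc, subst ennreal_mult') (auto simp: mult.assoc)
  finally show ?case .
qed simp

text \<open>Generation \<open>k\<close> covers at most the part 2^(-k) of \<open>R\<close>, so the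
  points that lie in all generations form a null set. Outside it the chain of cubes through a point
  is finite.\<close>

lemma AE_not_in_gen:
  assumes R: "0 < snd R"
  shows "AE x in lebesgue. \<exists>k. x \<notin> (\<Union>P\<in>gen R k. hcube P)"
proof -
  let ?U = "\<lambda>k. \<Union>P\<in>gen R k. hcube P"
  have U: "?U k \<in> sets lebesgue" for k
    using countable_gen[OF R] by (intro sets.countable_UN') auto
  let ?m = "measure lebesgue (hcube R)"
  have m: "emeasure lebesgue (hcube R) = ennreal ?m"
    using emeasure_hcube_finite[of R] by (intro emeasure_eq_ennreal_measure) auto
  have "emeasure lebesgue (\<Inter>k. ?U k) \<le> ennreal ((1 / 2) ^ k * ?m)" for k
  proof -
    have "emeasure lebesgue (\<Inter>k. ?U k) \<le> emeasure lebesgue (?U k)"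
      using U by (intro emeasure_mono) auto
    also have "\<dots> \<le> ennreal ((1 / 2) ^ k) * ennreal ?m"
      using emeasure_UN_gen[OF R, of k] by (simp only: m)
    finally show ?thesis by (simp only: ennreal_mult' measure_nonneg zero_le_power zero_le_divide_1_iff zero_le_numeral)
  qed
  moreover have "(\<lambda>k. ennreal ((1 / 2) ^ k * ?m)) \<longlonglongrightarrow> ennreal (0 * ?m)"
    by (intro tendsto_intros LIMSEQ_realpow_zero) auto
  ultimately have "emeasure lebesgue (\<Inter>k. ?U k) \<le> ennreal (0 * ?m)"
    by (intro LIMSEQ_le_const) auto
  then have "(\<Inter>k. ?U k) \<in> null_sets lebesgue"
    using U by (intro null_setsI sets.countable_INT'') auto
  then have "AE x in lebesgue. x \<notin> (\<Inter>k. ?U k)" by (rule AE_not_in)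
  then show ?thesis by eventually_elim auto
qed

lemma core_sets: "0 < snd P \<Longrightarrow> core P \<in> sets lebesgue"
  unfolding core_def using countable_ch by (intro sets.Diff sets.countable_UN') auto

lemma measure_core_ge:
  assumes P: "0 < snd P"
  shows "snd P ^ CARD('n) / 2 \<le> measure lebesgue (core P)"
proof -
  let ?U = "\<Union>P'\<in>ch P. hcube P'"
  have U: "?U \<in> sets lebesgue"
    using countable_ch[OF P] by (intro sets.countable_UN') auto
  have h: "emeasure lebesgue (hcube P) = ennreal (snd P ^ CARD('n))"
    using P by (intro emeasure_hcube) auto
  have "emeasure lebesgue (core P) \<le> emeasure lebesgue (hcube P)"
    by (intro emeasure_mono) (auto simp: core_def)
  then have c: "emeasure lebesgue (core P) = ennreal (measure lebesgue (core P))"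
    unfolding h by (intro emeasure_eq_ennreal_measure) (auto simp: top_unique)
  have "emeasure lebesgue (hcube P) \<le> emeasure lebesgue (core P \<union> ?U)"
    using core_sets[OF P] U by (intro emeasure_mono) (auto simp: core_def)
  also have "\<dots> \<le> emeasure lebesgue (core P) + emeasure lebesgue ?U"
    using core_sets[OF P] U by (intro emeasure_subadditive) auto
  also have "\<dots> \<le> emeasure lebesgue (core P) + ennreal (1 / 2) * emeasure lebesgue (hcube P)"
    by (intro add_left_mono ch_half[OF P])
  finally have "ennreal (snd P ^ CARD('n)) \<le> ennreal (measure lebesgue (core P) + 1 / 2 * snd P ^ CARD('n))"
    unfolding h c using ennreal_mult'[of "1 / 2" "snd P ^ CARD('n)"] P
    by (subst ennreal_plus) (simp_all only: measure_nonneg zero_le_power less_imp_le mult_nonneg_nonneg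
      zero_le_divide_1_iff zero_le_numeral)
  then show ?thesis
    using P by (subst (asm) ennreal_le_iff) auto
qed

lemma core_nonempty:
  assumes P: "0 < snd P" shows "core P \<noteq> {}"
proof
  assume "core P = {}"
  then have "snd P ^ CARD('n) / 2 \<le> 0" using measure_core_ge[OF P] by simp
  with P show False by (simp add: not_less[symmetric])
qed

text \<open>Later cubes lie in generation j+1. A cube of that generation through \<open>x\<close>
  has a parent through \<open>x\<close>, which must be \<open>P\<close> as generation
  \<open>j\<close> is disjoint, but a core avoids the children of its cube.\<close>

lemma core_later_disjoint:
  assumes R: "0 < snd R" and P: "P \<in> gen R j" "P' \<in> gen R k" "j < k" and x: "x \<in> core P"
  shows "x \<notin> hcube P'"
proof
  assume "x \<in> hcube P'"
  then have "x \<in> (\<Union>P\<in>gen R (Suc j). hcube P)"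
    using UN_gen_antimono[OF R, of "Suc j" k] P by (meson Suc_leI UN_I subsetD)
  then obtain P1 P2 where *: "P1 \<in> gen R j" "P2 \<in> ch P1" "x \<in> hcube P2" by auto
  then have "x \<in> hcube P1" using ch_props(2)[OF snd_gen[OF R]] by blast
  then have "P1 = P"
    using disjoint_gen[OF R, of j] * P(1) x unfolding disjoint_family_on_def core_def by blast
  then show False using * x by (auto simp: core_def)
qed

lemma core_disjoint:
  assumes R: "0 < snd R" and P: "P \<in> gen R j" "P' \<in> gen R k" and x: "x \<in> core P" "x \<in> core P'"
  shows "P = P'"
proof (cases j k rule: linorder_cases)
  case equal
  then show ?thesis
    using disjoint_gen[OF R, of j] P x unfolding disjoint_family_on_def core_def by blast
next
  case less
  then show ?thesis
    using core_later_disjoint[OF R P less x(1)] x(2) by (simp add: core_def)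
next
  case greater
  then show ?thesis
    using core_later_disjoint[OF R P(2,1) greater x(2)] x(1) by (simp add: core_def)
qed

text \<open>The descendants of a cube include the cube itself, so a repetition must be excluded: a
  repeated cube would miss its own core, which has positive measure. This lets a sum over a set of
  cubes count every step of a chain.\<close>

lemma gen_distinct:
  assumes R: "0 < snd R" and P: "P \<in> gen R j" "j < k" shows "P \<notin> gen R k"
proof
  assume k: "P \<in> gen R k"
  obtain x where "x \<in> core P" using core_nonempty[OF snd_gen[OF R P(1)]] by blast
  then show False
    using core_later_disjoint[OF R P(1) k P(2)] by (auto simp: core_def)
qed

text \<open>In the application \<open>\<Phi> P\<close> is |T(f \<chi>)| at \<open>x\<close> with
  truncation to \<open>dil P\<close>, and \<open>b P\<close> a multiple of the average. The
  estimates telescope along the cubes through \<open>x\<close>; the chain ends before generation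
  \<open>k\<close>, so a finite sum suffices.\<close>

lemma chain_domination:
  fixes \<Phi> b :: "(real ^ 'n) \<times> real \<Rightarrow> real"
  assumes R: "0 < snd R" and x: "x \<in> hcube R" and k: "x \<notin> (\<Union>P\<in>gen R k. hcube P)"
    and stop: "\<And>P j. P \<in> gen R j \<Longrightarrow> x \<in> hcube P \<Longrightarrow> x \<notin> (\<Union>P'\<in>ch P. hcube P') \<Longrightarrow> \<Phi> P \<le> b P"
    and step: "\<And>P P' j. P \<in> gen R j \<Longrightarrow> P' \<in> ch P \<Longrightarrow> x \<in> hcube P' \<Longrightarrow> \<Phi> P \<le> b P + \<Phi> P'"
  obtains A where "finite A" "A \<subseteq> (\<Union>j. gen R j)" "\<forall>P\<in>A. x \<in> hcube P" "\<Phi> R \<le> (\<Sum>P\<in>A. b P)"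
proof -
  define good where "good A m \<longleftrightarrow> finite A \<and> A \<subseteq> (\<Union>j<m. gen R j) \<and> (\<forall>P\<in>A. x \<in> hcube P)" for A m
  \<comment> \<open>Invariant: either the estimate is already closed, or one remainder
    \<open>\<Phi> P\<close> is left, with \<open>P\<close> in generation \<open>m\<close>.\<close>
  have "(\<exists>A. good A m \<and> \<Phi> R \<le> (\<Sum>P\<in>A. b P)) \<or>
      (\<exists>A P. good A m \<and> P \<in> gen R m \<and> x \<in> hcube P \<and> \<Phi> R \<le> (\<Sum>P\<in>A. b P) + \<Phi> P)" for m
  proof (induction m)
    case 0
    show ?case
      using x by (intro disjI2 exI[of _ "{}"] exI[of _ R]) (auto simp: good_def)
  next
    case (Suc m)
    from Suc show ?case
    proof (elim disjE exE conjE)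
      fix A assume "good A m" "\<Phi> R \<le> (\<Sum>P\<in>A. b P)"
      moreover from this have "good A (Suc m)"
        unfolding good_def using lessThan_Suc by blast
      ultimately show ?thesis by blast
    next
      fix A P assume A: "good A m" and P: "P \<in> gen R m" "x \<in> hcube P" and le: "\<Phi> R \<le> (\<Sum>P\<in>A. b P) + \<Phi> P"
      have "P \<notin> A"
      proof
        assume "P \<in> A"
        then obtain j where "j < m" "P \<in> gen R j" using A by (auto simp: good_def)
        then show False using gen_distinct[OF R] P by blast
      qed
      then have sum: "(\<Sum>P\<in>insert P A. b P) = b P + (\<Sum>P\<in>A. b P)"
        using A by (auto simp: good_def)
      have good: "good (insert P A) (Suc m)"
        using A P unfolding good_def lessThan_Suc by blast
      show ?thesis
      proof (cases "x \<in> (\<Union>P'\<in>ch P. hcube P')")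
        case True
        then obtain P' where P': "P' \<in> ch P" "x \<in> hcube P'" by blast
        have "\<Phi> R \<le> (\<Sum>P\<in>insert P A. b P) + \<Phi> P'"
          unfolding sum using le step[OF P(1) P'] by linarith
        moreover have "P' \<in> gen R (Suc m)" using P P' by auto
        ultimately show ?thesis using good P' by blast
      next
        case False
        then have "\<Phi> R \<le> (\<Sum>P\<in>insert P A. b P)"
          unfolding sum using le stop[OF P] by linarith
        then show ?thesis using good by blast
      qed
    qed
  qed
  from this[of k] obtain A where "good A k" "\<Phi> R \<le> (\<Sum>P\<in>A. b P)"
    using k by blast
  then show thesis
    unfolding good_def by (intro that[of A]) blast+
qed

end

subsection \<open>Starting cubes\<close>

text \<open>\<open>root_cube L x\<close> is the member containing \<open>x\<close> of a partition of the whole space into half-open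
  cubes whose threefold dilates all contain \<open>[-L, L]\<^sup>n\<close>: the cube of half side \<open>3\<^sup>k\<^sup>+\<^sup>1 L\<close> around
  the origin is cut into \<open>3\<^sup>n\<close> pieces, and all but the central piece are kept unless \<open>k = 0\<close>.\<close>
definition cell :: "real \<Rightarrow> real ^ 'n \<Rightarrow> (real ^ 'n) \<times> real"
  where "cell t x = (\<chi> i. if x $ i < - t then - 3 * t else if x $ i < t then - t else t, 2 * t)"

definition root_level :: "real \<Rightarrow> real ^ 'n \<Rightarrow> nat"
  where "root_level L x = (LEAST k. \<forall>i. - (3 ^ Suc k * L) \<le> x $ i \<and> x $ i < 3 ^ Suc k * L)"

definition root_cube :: "real \<Rightarrow> real ^ 'n \<Rightarrow> (real ^ 'n) \<times> real"
  where "root_cube L x = cell (3 ^ root_level L x * L) x"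

lemma root_level_bound:
  assumes "0 < L"
  shows "- (3 ^ Suc (root_level L x) * L) \<le> x $ i" "x $ i < 3 ^ Suc (root_level L x) * L"
proof -
  obtain k where k: "norm x / L < 3 ^ k"
    using real_arch_pow[of 3 "norm x / L"] by auto
  have "norm x < 3 ^ k * L" using k assms by (simp add: divide_less_eq)
  also have "\<dots> \<le> 3 ^ Suc k * L" using assms by simp
  finally have "\<bar>x $ j\<bar> < 3 ^ Suc k * L" for j
    using component_le_norm_cart[of x j] by linarith
  then have "\<forall>i. - (3 ^ Suc k * L) \<le> x $ i \<and> x $ i < 3 ^ Suc k * L"
    by (meson abs_less_iff less_imp_le minus_less_iff)
  then have "\<forall>i. - (3 ^ Suc (root_level L x) * L) \<le> x $ i \<and> x $ i < 3 ^ Suc (root_level L x) * L"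
    unfolding root_level_def by (rule LeastI)
  then show "- (3 ^ Suc (root_level L x) * L) \<le> x $ i" "x $ i < 3 ^ Suc (root_level L x) * L" by blast+
qed

lemma snd_root: "0 < L \<Longrightarrow> 0 < snd (root_cube L x)"
  by (simp add: root_cube_def cell_def)

lemma in_hcube_cell:
  "y \<in> hcube (cell t x) \<longleftrightarrow> (\<forall>i. (if x $ i < - t then - 3 * t \<le> y $ i \<and> y $ i < - t
     else if x $ i < t then - t \<le> y $ i \<and> y $ i < t else t \<le> y $ i \<and> y $ i < 3 * t))"
  by (auto simp: hcube_def cell_def)

lemma in_hcube_root:
  assumes "0 < L" shows "x \<in> hcube (root_cube L x)"
  unfolding root_cube_def in_hcube_cell
proof
  fix i
  show "if x $ i < - (3 ^ root_level L x * L) then - 3 * (3 ^ root_level L x * L) \<le> x $ i \<and> x $ i < - (3 ^ root_level L x * L)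
     else if x $ i < 3 ^ root_level L x * L then - (3 ^ root_level L x * L) \<le> x $ i \<and> x $ i < 3 ^ root_level L x * L
     else 3 ^ root_level L x * L \<le> x $ i \<and> x $ i < 3 * (3 ^ root_level L x * L)"
    using root_level_bound[OF assms, of x i] by auto
qed

lemma root_eq:
  assumes L: "0 < L" and y: "y \<in> hcube (root_cube L x)"
  shows "root_cube L y = root_cube L x"
proof -
  let ?t = "3 ^ root_level L x * L"
  have t: "0 < ?t" using L by simp
  have y': "if x $ i < - ?t then - 3 * ?t \<le> y $ i \<and> y $ i < - ?t
     else if x $ i < ?t then - ?t \<le> y $ i \<and> y $ i < ?t else ?t \<le> y $ i \<and> y $ i < 3 * ?t" for i
    using y unfolding root_cube_def in_hcube_cell by blast
  have "root_level L y = root_level L x"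
    unfolding root_level_def[of L y]
  proof (rule Least_equality)
    show "\<forall>i. - (3 ^ Suc (root_level L x) * L) \<le> y $ i \<and> y $ i < 3 ^ Suc (root_level L x) * L"
    proof
      fix i show "- (3 ^ Suc (root_level L x) * L) \<le> y $ i \<and> y $ i < 3 ^ Suc (root_level L x) * L"
        using y'[of i] t by (auto split: if_splits)
    qed
    fix k assume k: "\<forall>i. - (3 ^ Suc k * L) \<le> y $ i \<and> y $ i < 3 ^ Suc k * L"
    show "root_level L x \<le> k"
    \<comment> \<open>If \<open>y\<close> lay in the cube of half side \<open>?t\<close>, its cell
      would be the central one, so \<open>x\<close> would lie there too; this contradicts the
      minimality of the level of \<open>x\<close>, because \<open>?t\<close> bounds the region of
      the previous level.\<close>
    proof (rule ccontr)
      assume "\<not> root_level L x \<le> k"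
      then have "Suc k \<le> root_level L x" by simp
      then have "(3::real) ^ Suc k \<le> 3 ^ root_level L x" by (intro power_increasing) auto
      then have le: "3 ^ Suc k * L \<le> ?t" using L by (intro mult_right_mono) auto
      have "- ?t \<le> x $ i \<and> x $ i < ?t" for i
        using y'[of i] k[rule_format, of i] le by (auto split: if_splits)
      moreover obtain m where m: "root_level L x = Suc m"
        using \<open>Suc k \<le> root_level L x\<close> by (cases "root_level L x") auto
      ultimately have "root_level L x \<le> m"
        unfolding root_level_def[of L x] by (intro Least_le) (metis m root_level_def)
      then show False using m by simp
    qed
  qed
  moreover have "(y $ i < - ?t) = (x $ i < - ?t)" "(y $ i < ?t) = (x $ i < ?t)" for i
    using y'[of i] t by (auto split: if_splits)
  ultimately show ?thesis
    by (simp only: root_cube_def cell_def)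
qed

lemma disjoint_roots:
  assumes "0 < L" shows "disjoint_family_on hcube (range (root_cube L))"
proof -
  have "root_cube L x = root_cube L x'" if "y \<in> hcube (root_cube L x)" "y \<in> hcube (root_cube L x')" for x x' y
    using root_eq[OF assms] that by metis
  then show ?thesis
    unfolding disjoint_family_on_def by blast
qed

lemma countable_roots: "0 < L \<Longrightarrow> countable (range (root_cube L))"
  by (rule countable_disjoint_hcubes[OF _ disjoint_roots]) (auto simp: snd_root)

text \<open>With t the half side of the root, the centre has coordinates at most 2t and
  \<open>y\<close> at most t, so their distance 3t must fit into the half side \<alpha>t. This is
  the source of the condition \<open>3 \<le> \<alpha>\<close>.\<close>

lemma dilate_root_contains:
  assumes L: "0 < L" and \<alpha>: "3 \<le> \<alpha>" and y: "\<And>i. \<bar>y $ i\<bar> \<le> L"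
  shows "y \<in> cube (ctr (root_cube L x)) (\<alpha> * snd (root_cube L x))"
  unfolding mem_cube_iff
proof
  fix i
  let ?t = "3 ^ root_level L x * L"
  have "1 * L \<le> ?t" using L by (intro mult_right_mono) auto
  then have "\<bar>y $ i\<bar> \<le> ?t" using y[of i] by simp
  moreover have "\<bar>ctr (root_cube L x) $ i\<bar> \<le> 2 * ?t"
    using L by (simp add: ctr_def root_cube_def cell_def)
  moreover have "3 * ?t \<le> \<alpha> * ?t" using L \<alpha> by (intro mult_right_mono) auto
  moreover have "\<alpha> * snd (root_cube L x) / 2 = \<alpha> * ?t"
    by (simp add: root_cube_def cell_def)
  ultimately show "\<bar>y $ i - ctr (root_cube L x) $ i\<bar> \<le> \<alpha> * snd (root_cube L x) / 2"
    by linarith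
qed

section \<open>Assembly of the sparse family\<close>

context sparse_domination
begin

lemma dil_inj:
  assumes "0 < snd P" "0 < snd P'" "dil P = dil P'"
  shows "P = P'"
proof -
  have pos: "0 < \<alpha> * snd P" "0 < \<alpha> * snd P'" using assms \<alpha> by auto
  have "ctr P = ctr P'" "\<alpha> * snd P = \<alpha> * snd P'"
    using assms(3) cube_eq_iff[OF pos] by (auto simp: dil_def)
  then show ?thesis
    using \<alpha> by (simp add: ctr_def prod_eq_iff)
qed

lemma C0_pos: "0 < C0"
  using c2_ge c3_ge by (simp add: C0_def)

lemma sparse_bound:
  assumes f: "f \<in> Lp s UNIV" and supp: "compact (closure {x. f x \<noteq> 0})"
  shows "\<exists>S. sparse_family (1 / (2 * \<alpha> ^ CARD('n))) S \<and>
    (AE x in lebesgue. ennreal (norm (T f x)) \<le>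
      ennreal (C0 * (\<psi> lam + N)) * (\<Sum>\<^sub>\<infinity>Q\<in>S. ennreal (avg s f Q) * indicator Q x))"
proof -
  define b where "b P = C0 * (\<psi> lam + N) * avg s f (dil P)" for P
  define \<Phi> where "\<Phi> x P = norm (T (restr (dil P) f) x)" for x P
  define step where "step Q F \<longleftrightarrow> F \<subseteq> descendants Q \<and> disjoint_family_on hcube F \<and>
      emeasure lebesgue (\<Union>P\<in>F. hcube P) \<le> ennreal (1 / 2) * emeasure lebesgue (hcube Q) \<and>
      (AE x in lebesgue. x \<in> hcube Q \<longrightarrow> x \<notin> (\<Union>P\<in>F. hcube P) \<longrightarrow> \<Phi> x Q \<le> b Q) \<and>
      (AE x in lebesgue. \<forall>P\<in>F. x \<in> hcube P \<longrightarrow> \<Phi> x Q \<le> b Q + \<Phi> x P)" for Q F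
  define ch where "ch Q = (SOME F. step Q F)" for Q
  have "step Q (ch Q)" if "0 < snd Q" for Q
    unfolding ch_def using local_domination[OF f that] unfolding step_def b_def \<Phi>_def by (rule someI_ex)
  then have ch: "ch Q \<subseteq> descendants Q" "disjoint_family_on hcube (ch Q)"
      "emeasure lebesgue (\<Union>P\<in>ch Q. hcube P) \<le> ennreal (1 / 2) * emeasure lebesgue (hcube Q)"
      "AE x in lebesgue. x \<in> hcube Q \<longrightarrow> x \<notin> (\<Union>P\<in>ch Q. hcube P) \<longrightarrow> \<Phi> x Q \<le> b Q"
      "AE x in lebesgue. \<forall>P\<in>ch Q. x \<in> hcube P \<longrightarrow> \<Phi> x Q \<le> b Q + \<Phi> x P" if "0 < snd Q" for Q
    using that unfolding step_def by blast+
  interpret sparse_children ch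
    by unfold_locales (use ch in blast)+
  obtain L where L: "0 < L" and supp_L: "\<And>x. f x \<noteq> 0 \<Longrightarrow> norm x \<le> L"
  proof -
    have "bounded {x. f x \<noteq> 0}"
      using supp compact_imp_bounded bounded_subset closure_subset by metis
    then obtain B where "0 < B" "\<And>x. x \<in> {x. f x \<noteq> 0} \<Longrightarrow> norm x \<le> B"
      unfolding bounded_pos by blast
    then show thesis by (intro that[of B]) auto
  qed
  define Rs :: "((real ^ 'n) \<times> real) set" where "Rs = range (root_cube L)"
  define F where "F = (\<Union>R\<in>Rs. \<Union>k. gen R k)"
  have Rs_pos: "0 < snd R" if "R \<in> Rs" for R
    using that snd_root[OF L] by (auto simp: Rs_def)
  have F_pos: "0 < snd P" if "P \<in> F" for P
    using that snd_gen Rs_pos unfolding F_def by blast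
  have cRs: "countable Rs" unfolding Rs_def by (rule countable_roots[OF L])
  then have cF: "countable F"
    unfolding F_def by (intro countable_UN countable_gen Rs_pos) auto
  have inj: "inj_on dil F"
    by (rule inj_onI) (rule dil_inj[OF F_pos F_pos])
  have core_F: "P = P'" if P: "P \<in> F" "P' \<in> F" and x: "x \<in> core P" "x \<in> core P'" for P P' x
  proof -
    obtain R k R' k' where R: "R \<in> Rs" "P \<in> gen R k" "R' \<in> Rs" "P' \<in> gen R' k'"
      using P by (auto simp: F_def)
    then have "x \<in> hcube R" "x \<in> hcube R'"
      using x hcube_gen_subset[OF Rs_pos] unfolding core_def by blast+
    then have "R = R'"
      using R disjoint_roots[OF L] unfolding Rs_def disjoint_family_on_def by blast
    then show ?thesis
      using core_disjoint[OF Rs_pos] R x by blast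
  qed
  have sparse: "sparse_family (1 / (2 * \<alpha> ^ CARD('n))) (dil ` F)"
    unfolding sparse_family_def
  \<comment> \<open>Sparseness asks for sets indexed by the closed cubes; by injectivity of
    \<open>dil\<close> the inverse returns the pair whose core is meant. Half of \<open>P\<close> is
    the part 1 / (2 \<alpha>^n) of its dilate.\<close>
  proof (intro conjI exI[of _ "\<lambda>Q. core (inv_into F dil Q)"] ballI)
    have "1 \<le> \<alpha> ^ CARD('n)" using \<alpha> by (intro one_le_power) auto
    then show "0 < 1 / (2 * \<alpha> ^ CARD('n))" "1 / (2 * \<alpha> ^ CARD('n)) \<le> 1"
      by (auto simp: divide_le_eq)
    have "0 < \<alpha> * snd P" if "P \<in> F" for P using F_pos[OF that] \<alpha> by simp
    then show "dil ` F \<subseteq> cubes" unfolding cubes_def dil_def by blast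
    show "disjoint_family_on (\<lambda>Q. core (inv_into F dil Q)) (dil ` F)"
    proof (clarsimp simp only: disjoint_family_on_def ball_simps inv_into_f_f[OF inj])
      fix P P' assume "P \<in> F" "P' \<in> F" "dil P \<noteq> dil P'"
      then show "core P \<inter> core P' = {}" using core_F by blast
    qed
    fix Q assume "Q \<in> dil ` F"
    then obtain P where P: "P \<in> F" "Q = dil P" by blast
    then have inv: "inv_into F dil Q = P" using inj by simp
    note pos = F_pos[OF P(1)]
    show "core (inv_into F dil Q) \<in> sets lebesgue"
      unfolding inv by (rule core_sets[OF pos])
    show "core (inv_into F dil Q) \<subseteq> Q"
      unfolding inv unfolding P(2) using hcube_subset_dil[OF pos] by (auto simp: core_def)
    show "1 / (2 * \<alpha> ^ CARD('n)) * measure lebesgue Q \<le> measure lebesgue (core (inv_into F dil Q))"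
      unfolding inv unfolding P(2) measure_dil[OF pos]
      using measure_core_ge[OF pos] \<alpha> by (simp add: power_mult_distrib)
  qed
  have "AE x in lebesgue. \<forall>R\<in>Rs. \<exists>k. x \<notin> (\<Union>P\<in>gen R k. hcube P)"
    using AE_not_in_gen Rs_pos cRs by (simp add: AE_ball_countable)
  moreover have "AE x in lebesgue. \<forall>Q\<in>F. x \<in> hcube Q \<longrightarrow> x \<notin> (\<Union>P\<in>ch Q. hcube P) \<longrightarrow> \<Phi> x Q \<le> b Q"
    using ch F_pos by (subst AE_ball_countable[OF cF]) blast
  moreover have "AE x in lebesgue. \<forall>Q\<in>F. \<forall>P\<in>ch Q. x \<in> hcube P \<longrightarrow> \<Phi> x Q \<le> b Q + \<Phi> x P"
    using ch F_pos by (subst AE_ball_countable[OF cF]) blast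
  ultimately have "AE x in lebesgue. ennreal (norm (T f x)) \<le>
      ennreal (C0 * (\<psi> lam + N)) * (\<Sum>\<^sub>\<infinity>Q\<in>dil ` F. ennreal (avg s f Q) * indicator Q x)"
  proof eventually_elim
    case (elim x)
    define R where "R = root_cube L x"
    have R: "R \<in> Rs" "0 < snd R" "x \<in> hcube R"
      using in_hcube_root[OF L] snd_root[OF L] by (auto simp: R_def Rs_def)
    then obtain k where k: "x \<notin> (\<Union>P\<in>gen R k. hcube P)" using elim(1) by blast
    have gen_F: "gen R j \<subseteq> F" for j using R by (auto simp: F_def)
    obtain A where A: "finite A" "A \<subseteq> (\<Union>j. gen R j)" "\<forall>P\<in>A. x \<in> hcube P" "\<Phi> x R \<le> (\<Sum>P\<in>A. b P)"
    proof (rule chain_domination[OF R(2,3) k])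
      show "\<Phi> x P \<le> b P" if "P \<in> gen R j" "x \<in> hcube P" "x \<notin> (\<Union>P'\<in>ch P. hcube P')" for P j
        using elim(2) that gen_F by blast
      show "\<Phi> x P \<le> b P + \<Phi> x P'" if "P \<in> gen R j" "P' \<in> ch P" "x \<in> hcube P'" for P P' j
        using elim(3) that gen_F by blast
    qed
    have AF: "A \<subseteq> F" using A(2) gen_F by blast
    \<comment> \<open>The dilate of the root contains the support, so the chain starts with |T f|
      itself, whichever root contains \<open>x\<close>.\<close>
    have "restr (dil R) f y = f y" for y
    proof (cases "f y = 0")
      case False
      then have "\<bar>y $ i\<bar> \<le> L" for i
        using supp_L[of y] component_le_norm_cart[of y i] by linarith
      then have "y \<in> dil R"
        unfolding dil_def R_def by (rule dilate_root_contains[OF L \<alpha>])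
      then show ?thesis by (simp add: restr_def)
    qed (simp add: restr_def)
    then have "restr (dil R) f = f" by (rule ext)
    then have "norm (T f x) \<le> (\<Sum>P\<in>A. b P)" using A(4) by (simp add: \<Phi>_def)
    then have "ennreal (norm (T f x)) \<le> ennreal (C0 * (\<psi> lam + N) * (\<Sum>P\<in>A. avg s f (dil P)))"
      by (intro ennreal_leI) (simp add: b_def sum_distrib_left)
    also have "\<dots> = ennreal (C0 * (\<psi> lam + N)) * (\<Sum>P\<in>A. ennreal (avg s f (dil P)))"
      using C0_pos \<psi>_nonneg N_nonneg by (simp add: ennreal_mult sum_nonneg)
    also have "(\<Sum>P\<in>A. ennreal (avg s f (dil P))) = (\<Sum>P\<in>A. ennreal (avg s f (dil P)) * indicator (dil P) x)"
    proof (intro sum.cong refl)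
      fix P assume "P \<in> A"
      then have "x \<in> dil P" using A(3) AF F_pos hcube_subset_dil by blast
      then show "ennreal (avg s f (dil P)) = ennreal (avg s f (dil P)) * indicator (dil P) x" by simp
    qed
    also have "\<dots> = (\<Sum>Q\<in>dil ` A. ennreal (avg s f Q) * indicator Q x)"
      using inj_on_subset[OF inj AF] by (simp add: sum.reindex)
    \<comment> \<open>The finite set \<open>A\<close> depends on \<open>x\<close>; enlarging it to
      the whole family gives one bound for almost every \<open>x\<close>, and in
      \<open>ennreal\<close> no convergence is at issue.\<close>
    also have "\<dots> \<le> (\<Sum>\<^sub>\<infinity>Q\<in>dil ` F. ennreal (avg s f Q) * indicator Q x)"
      unfolding infsum_finite[OF finite_imageI[OF A(1)], symmetric]
      using AF by (intro infsum_mono_neutral nonneg_summable_on_complete) auto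
    finally show ?case by (simp add: mult_left_mono)
  qed
  with sparse show ?thesis by blast
qed

end

theorem theorem1p1:
  fixes r s \<alpha> :: real
  assumes "1 \<le> r" and "3 \<le> \<alpha>"
  shows "\<exists>c>0. \<forall>(q::real) (D :: (real ^ 'n \<Rightarrow> 'k::{real_normed_field, euclidean_space}) set)
           (T :: (real ^ 'n \<Rightarrow> 'k) \<Rightarrow> real ^ 'n \<Rightarrow> 'k) (\<psi> :: real \<Rightarrow> real).
    1 \<le> q \<longrightarrow> s = max q r \<longrightarrow>
    operator_domain q r \<alpha> D \<longrightarrow> (\<forall>f\<in>D. T f \<in> borel_measurable lebesgue) \<longrightarrow>
    sublinear_on D T \<longrightarrow> W_condition q T \<psi> \<longrightarrow> weak_type r (sharp_max T \<alpha>) \<longrightarrow>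
    (\<forall>f\<in>Lp s UNIV. compact (closure {x. f x \<noteq> 0}) \<longrightarrow>
       (\<exists>S. sparse_family (1 / (2 * \<alpha> ^ CARD('n))) S \<and>
         (AE x in lebesgue.
            ennreal (norm (T f x)) \<le>
              ennreal (c * (\<psi> (1 / (12 * (2 * \<alpha>) ^ CARD('n))) + weak_type_norm r (sharp_max T \<alpha>))) *
              (\<Sum>\<^sub>\<infinity>Q\<in>S. ennreal (avg s f Q) * indicator Q x))))"
proof -
  let ?c2 = "12 * (2 * \<alpha>) ^ CARD('n)"
  \<comment> \<open>This is \<open>C0\<close> unfolded. It has to be written outside the locale
    because it is chosen before \<open>q\<close>, \<open>T\<close> and \<open>\<psi>\<close>; it
    depends on the dimension and \<open>\<alpha>\<close> alone.\<close>
  let ?C = "2 * (?c2 + 1 + (5 * real CARD('n)) ^ CARD('n) * ?c2)"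
  show ?thesis
  proof (intro exI[of _ ?C] conjI allI impI ballI)
    show "0 < ?C" using \<open>3 \<le> \<alpha>\<close> by (intro mult_pos_pos add_pos_nonneg) auto
    fix q :: real and D :: "(real ^ 'n \<Rightarrow> 'k) set" and T :: "(real ^ 'n \<Rightarrow> 'k) \<Rightarrow> real ^ 'n \<Rightarrow> 'k"
      and \<psi> :: "real \<Rightarrow> real" and f :: "real ^ 'n \<Rightarrow> 'k"
    assume "1 \<le> q" "s = max q r" "operator_domain q r \<alpha> D" "\<forall>f\<in>D. T f \<in> borel_measurable lebesgue"
      "sublinear_on D T" "W_condition q T \<psi>" "weak_type r (sharp_max T \<alpha>)"
      and f: "f \<in> Lp s UNIV" "compact (closure {x. f x \<noteq> 0})"
    then interpret sparse_domination q r s \<alpha> D T \<psi>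
      using assms by unfold_locales auto
    show "\<exists>S. sparse_family (1 / (2 * \<alpha> ^ CARD('n))) S \<and>
         (AE x in lebesgue.
            ennreal (norm (T f x)) \<le>
              ennreal (?C * (\<psi> (1 / (12 * (2 * \<alpha>) ^ CARD('n))) + weak_type_norm r (sharp_max T \<alpha>))) *
              (\<Sum>\<^sub>\<infinity>Q\<in>S. ennreal (avg s f Q) * indicator Q x))"
      using sparse_bound[OF f] unfolding C0_def c3_def c2_def lam_def N_def .
  qed
qed

end
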